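(* Fix a positional scoring rule given by $\vec{\alpha}=(\alpha_0,\ldots,\alpha_m)$. There is a constant $d>0$ such that, with $\beta=d\sqrt{m\log m}$ and $g(\vec{\alpha})=\max_{i=0,\ldots,m-\beta}\lvert\alpha_{i+\beta}-\alpha_i\rvert$, there exists a randomized Monte Carlo algorithm for $\mathcal{R}_{\vec{\alpha}}$-UCM which, given $(\sigma_0,\ldots,\sigma_m)$ and $k$, outputs a manipulation strategy $S$ such that $\max_{1\le i\le m}\mathrm{score}_S(c_i)\le T^*+k\cdot g(\vec{\alpha})$, except with a failure probability that is exponentially small in $m$.
   Context: Positional scoring rule $\mathcal{R}_{\vec{\alpha}}$: $\vec{\alpha}=(\alpha_0,\ldots,\alpha_m)$ with $0\le\alpha_0\le\alpha_1\le\cdots\le\alpha_m$ integers, $\alpha_m$ bounded by a polynomial in $m$. There are $m+1$ candidates $p=c_0,c_1,\ldots,c_m$; $p$ is the preferred candidate. The non-manipulators' votes are summarized by a score profile $(\sigma_0,\ldots,\sigma_m)$ of arbitrary nonnegative integers (the scores received so far). In $\mathcal{R}_{\vec{\alpha}}$-UCM (unweighted coalitional manipulation) there are $k$ manipulators; each manipulator submits a ranking, i.e. assigns the scores $\alpha_0,\ldots,\alpha_m$ bijectively to the $m+1$ candidates. A manipulation strategy $S$ is the collection of the $k$ rankings; the final score $\mathrm{score}_S(c_i)$ of $c_i$ is $\sigma_i$ plus the sum of the scores assigned to $c_i$ by the $k$ manipulators. $T^*=\min_S\max_{1\le i\le m}\mathrm{score}_S(c_i)$ is the minimum, over all strategies,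 of the highest final score of a non-preferred candidate. $\beta$ is treated as an integer (rounded). *)

theory Defs
  imports
    "HOL-Probability.Probability"
    "HOL-Computational_Algebra.Polynomial"
    "HOL-Library.Log_Nat"
begin

section \<open>Randomized programs\<close>

text \<open>
  A structured random access machine over the natural numbers.  The memory consists of arrays,
  all cells being 0 unless set by the input; a program mentions only finitely many arrays
  explicitly, so this is an ordinary RAM with indirect addressing.  Arithmetic is restricted to
  addition and truncated subtraction: without a multiplication primitive, \<open>t\<close> steps can only
  increase the bit length of the largest number by \<open>O(t)\<close>, so that counting one unit of time per
  step is polynomially equivalent to Turing machine time.
\<close>

datatype arr = Input nat | Output | Work nat

type_synonym store = "arr \<Rightarrow> nat \<Rightarrow> nat"

datatype aexp = Const nat | Load arr aexp | Plus aexp aexp | Minus aexp aexp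

datatype bexp = BLess aexp aexp | BNot bexp | BAnd bexp bexp

datatype com =
    Skip
  | Store arr aexp aexp
  | Flip arr aexp
  | Seq com com
  | Cond bexp com com
  | While bexp com

primrec aval :: "aexp \<Rightarrow> store \<Rightarrow> nat" where
  "aval (Const n) s = n"
| "aval (Load a e) s = s a (aval e s)"
| "aval (Plus e1 e2) s = aval e1 s + aval e2 s"
| "aval (Minus e1 e2) s = aval e1 s - aval e2 s"

primrec bval :: "bexp \<Rightarrow> store \<Rightarrow> bool" where
  "bval (BLess e1 e2) s \<longleftrightarrow> aval e1 s < aval e2 s"
| "bval (BNot b) s \<longleftrightarrow> \<not> bval b s"
| "bval (BAnd b1 b2) s \<longleftrightarrow> bval b1 s \<and> bval b2 s"

definition upd :: "store \<Rightarrow> arr \<Rightarrow> nat \<Rightarrow> nat \<Rightarrow> store" where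
  "upd s a i v = s(a := (s a)(i := v))"

text \<open>One step of computation; \<open>Flip a e\<close> stores a fair random bit.\<close>

primrec step :: "com \<Rightarrow> store \<Rightarrow> (com \<times> store) pmf" where
  "step Skip s = return_pmf (Skip, s)"
| "step (Store a e1 e2) s = return_pmf (Skip, upd s a (aval e1 s) (aval e2 s))"
| "step (Flip a e) s =
     map_pmf (\<lambda>b. (Skip, upd s a (aval e s) (of_bool b))) (bernoulli_pmf (1/2))"
| "step (Seq c1 c2) s =
     (if c1 = Skip then return_pmf (c2, s)
      else map_pmf (\<lambda>(c1', s'). (Seq c1' c2, s')) (step c1 s))"
| "step (Cond b c1 c2) s = return_pmf (if bval b s then c1 else c2, s)"
| "step (While b c) s = return_pmf (if bval b s then Seq c (While b c) else Skip, s)"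

primrec run :: "nat \<Rightarrow> com \<Rightarrow> store \<Rightarrow> (com \<times> store) pmf" where
  "run 0 c s = return_pmf (c, s)"
| "run (Suc n) c s = bind_pmf (step c s) (\<lambda>(c', s'). run n c' s')"

definition halts_within :: "nat \<Rightarrow> com \<Rightarrow> store \<Rightarrow> bool" where
  "halts_within t c s \<longleftrightarrow> (\<forall>(c', s') \<in> set_pmf (run t c s). c' = Skip)"

definition final_store :: "nat \<Rightarrow> com \<Rightarrow> store \<Rightarrow> store pmf" where
  "final_store t c s = map_pmf snd (run t c s)"


section \<open>Unweighted coalitional manipulation\<close>

text \<open>
  A scoring rule is a family of vectors, \<open>\<alpha> m = (\<alpha> m 0, \<dots>, \<alpha> m m)\<close> being the one used for
  \<open>m + 1\<close> candidates; only so is it meaningful to bound the scores polynomially in \<open>m\<close>.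
\<close>

definition positional_scoring_rule :: "(nat \<Rightarrow> nat \<Rightarrow> nat) \<Rightarrow> bool" where
  "positional_scoring_rule \<alpha> \<longleftrightarrow>
     (\<forall>m. mono_on {0..m} (\<alpha> m)) \<and> (\<exists>q :: nat poly. \<forall>m. \<alpha> m m \<le> poly q m)"

text \<open>
  In a strategy \<open>S\<close>, manipulator \<open>r < k\<close> gives to candidate \<open>i\<close> the score with index \<open>S r i\<close>;
  candidate 0 is the preferred one.  Below, \<open>a\<close> is a single score vector.
\<close>

definition strategies :: "nat \<Rightarrow> nat \<Rightarrow> (nat \<Rightarrow> nat \<Rightarrow> nat) set" where
  "strategies m k = {S. \<forall>r<k. bij_betw (S r) {0..m} {0..m}}"

definition score ::
  "(nat \<Rightarrow> nat) \<Rightarrow> (nat \<Rightarrow> nat) \<Rightarrow> nat \<Rightarrow> (nat \<Rightarrow> nat \<Rightarrow> nat) \<Rightarrow> nat \<Rightarrow> nat" where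
  "score a \<sigma> k S i = \<sigma> i + (\<Sum>r<k. a (S r i))"

definition max_score ::
  "(nat \<Rightarrow> nat) \<Rightarrow> nat \<Rightarrow> (nat \<Rightarrow> nat) \<Rightarrow> nat \<Rightarrow> (nat \<Rightarrow> nat \<Rightarrow> nat) \<Rightarrow> nat" where
  "max_score a m \<sigma> k S = (MAX i\<in>{1..m}. score a \<sigma> k S i)"

definition opt_score :: "(nat \<Rightarrow> nat) \<Rightarrow> nat \<Rightarrow> (nat \<Rightarrow> nat) \<Rightarrow> nat \<Rightarrow> nat" where
  "opt_score a m \<sigma> k = (MIN S\<in>strategies m k. max_score a m \<sigma> k S)"

definition beta :: "real \<Rightarrow> nat \<Rightarrow> nat" where
  "beta d m = nat (round (d * sqrt (real m * ln (real m))))"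

text \<open>Meaningful only for \<open>\<beta> \<le> m\<close>; otherwise the index range of the maximum should be empty.\<close>

definition gap :: "(nat \<Rightarrow> nat) \<Rightarrow> nat \<Rightarrow> nat \<Rightarrow> int" where
  "gap a m \<beta> = (MAX i\<in>{0..m - \<beta>}. \<bar>int (a (i + \<beta>)) - int (a i)\<bar>)"

definition ucm_input :: "(nat \<Rightarrow> nat) \<Rightarrow> nat \<Rightarrow> (nat \<Rightarrow> nat) \<Rightarrow> nat \<Rightarrow> store" where
  "ucm_input a m \<sigma> k =
     (\<lambda>_ _. 0)(Input 0 := (\<lambda>_. 0)(0 := m, 1 := k),
               Input 1 := (\<lambda>i. if i \<le> m then a i else 0),
               Input 2 := (\<lambda>i. if i \<le> m then \<sigma> i else 0))"

text \<open>
  The number of manipulators counts in unary since \<open>k\<close> rankings have to be written; the scores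
  \<open>\<sigma>\<close> count in binary.  The vector \<open>\<alpha> m\<close> has size polynomial in \<open>m\<close> anyway.
\<close>

definition ucm_size :: "nat \<Rightarrow> (nat \<Rightarrow> nat) \<Rightarrow> nat \<Rightarrow> nat" where
  "ucm_size m \<sigma> k = m + k + (\<Sum>i\<le>m. floorlog 2 (\<sigma> i))"

definition ucm_output :: "nat \<Rightarrow> store \<Rightarrow> nat \<Rightarrow> nat \<Rightarrow> nat" where
  "ucm_output m s r i = s Output (r * (m + 1) + i)"

end

theory Submission
  imports Defs
begin

text \<open>
  A deterministic local search suffices.  Look for integers \<open>S r i < m\<close> (the index which manipulator
  \<open>r\<close> would like to give to candidate \<open>i \<ge> 1\<close>) such that the scores of every candidate respect a
  guessed bound \<open>T\<close>, while the rows need not be permutations.  The imbalance of row \<open>r\<close> at threshold \<open>j\<close> is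
  \<open>e r j = #{i. S r i \<le> j} - (j + 1)\<close>; if all imbalances are at most \<open>\<beta>\<close>, then sorting each row turns
  it into a permutation that raises each index by at most \<open>\<beta>\<close>, which costs at most \<open>k\<close> times the gap.

  The potential is the sum of \<open>(1 + 1/q) ^ e r j\<close>, with \<open>q\<close> about \<open>sqrt (m / ln m)\<close>.  A move replaces the column
  of one candidate by any column within the budget; the best move is found by a knapsack dynamic
  program, which is polynomial as the scores are.  Averaging the first-order change over the moves
  towards the columns of an optimal strategy (whose imbalances vanish) shows that in a local optimum
  the mean over \<open>r\<close> of the row potentials is polynomial in \<open>m\<close>.  Averaging over the moves that exchange two
  entries of a column bounds the largest row potential by a polynomial in \<open>m\<close> too, uniformly in \<open>k\<close>.  So all
  imbalances are \<open>O(sqrt (m ln m))\<close>.  As long as this fails, a step gains a factor \<open>1 - 1/(k q\<^sup>2)\<close>, hence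
  \<open>3 k m\<^sup>2\<close> steps suffice.  The program tries all \<open>T\<close> and \<open>q\<close> and keeps the best strategy it meets.
\<close>

section \<open>Bounded loops\<close>

text \<open>Runs without a coin flip, counted in steps. The side condition excludes the self-loop of
  \<open>Skip\<close>, which \<open>Seq\<close> does not imitate; this is what makes
  \<open>steps_Seq\<close> hold.\<close>

inductive steps :: "nat \<Rightarrow> com \<Rightarrow> store \<Rightarrow> com \<Rightarrow> store \<Rightarrow> bool" where
  steps_0: "steps 0 c s c s"
| steps_Suc: "c \<noteq> Skip \<Longrightarrow> step c s = return_pmf (c1, s1) \<Longrightarrow> steps n c1 s1 c' s' \<Longrightarrow> steps (Suc n) c s c' s'"

lemma steps_trans:
  "steps n1 c s c1 s1 \<Longrightarrow> steps n2 c1 s1 c2 s2 \<Longrightarrow> steps (n1 + n2) c s c2 s2"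
  by (induction rule: steps.induct) (auto intro: steps.intros)

lemma steps_1: "c \<noteq> Skip \<Longrightarrow> step c s = return_pmf (c1, s1) \<Longrightarrow> steps 1 c s c1 s1"
  by (simp add: steps_0 steps_Suc)

lemma steps_Seq: "steps n c1 s c1' s' \<Longrightarrow> steps n (Seq c1 c2) s (Seq c1' c2) s'"
  by (induction rule: steps.induct) (auto intro: steps.intros)

text \<open>The extra step is the one in which \<open>Seq\<close> drops a finished
  \<open>Skip\<close>.\<close>

lemma steps_Seq_Skip:
  assumes "steps n1 c1 s Skip s1" "steps n2 c2 s1 c' s2"
  shows "steps (n1 + 1 + n2) (Seq c1 c2) s c' s2"
proof -
  have "steps 1 (Seq Skip c2) s1 c2 s1"
    by (rule steps_1) auto
  with steps_Seq[OF assms(1)] assms(2) show ?thesis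
    by (blast intro: steps_trans)
qed

lemma run_Skip: "run n Skip s = return_pmf (Skip, s)"
  by (induction n) (auto simp: bind_return_pmf)

text \<open>A finished run stays at \<open>Skip\<close>, so it may be padded to any larger time
  bound, and the distribution at that time is a point mass.\<close>

lemma run_steps:
  "steps n c s Skip s' \<Longrightarrow> n \<le> t \<Longrightarrow> run t c s = return_pmf (Skip, s')"
proof (induction n c s "Skip" s' arbitrary: t rule: steps.induct)
  case (steps_0 s)
  then show ?case by (simp add: run_Skip)
next
  case (steps_Suc c s c1 s1 n s')
  then obtain u where "t = Suc u" "n \<le> u" by (cases t) auto
  then show ?case using steps_Suc by (simp add: bind_return_pmf)
qed

text \<open>
  Programs whose loops are bounded by a cell of the array \<open>par\<close> that the body does not write: they have
  a total semantics, and their running time is a polynomial in the largest entry of \<open>par\<close>.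
\<close>

abbreviation par :: arr where "par \<equiv> Work 0"

datatype lcom =
    NOP
  | ASSIGN arr aexp aexp
  | SEQ lcom lcom (infixr \<open>;;\<close> 60)
  | IF bexp lcom lcom
  | FOR arr nat lcom

primrec compile :: "lcom \<Rightarrow> com" where
  "compile NOP = Skip"
| "compile (ASSIGN a e1 e2) = Store a e1 e2"
| "compile (c1 ;; c2) = Seq (compile c1) (compile c2)"
| "compile (IF b c1 c2) = Cond b (compile c1) (compile c2)"
| "compile (FOR v p c) =
     Seq (Store v (Const 0) (Const 0))
         (While (BLess (Load v (Const 0)) (Load par (Const p)))
                (Seq (compile c) (Store v (Const 0) (Plus (Load v (Const 0)) (Const 1)))))"

text \<open>The counter is rewritten before each pass and the increment after the body is left out,
  so \<open>upd (loop f v i s) v 0 i\<close> is the store at which the compiled \<open>While\<close>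
  tests the counter value \<open>i\<close>.\<close>

primrec loop :: "(store \<Rightarrow> store) \<Rightarrow> arr \<Rightarrow> nat \<Rightarrow> store \<Rightarrow> store" where
  "loop f v 0 s = s"
| "loop f v (Suc n) s = f (upd (loop f v n s) v 0 n)"

primrec eval :: "lcom \<Rightarrow> store \<Rightarrow> store" where
  "eval NOP s = s"
| "eval (ASSIGN a e1 e2) s = upd s a (aval e1 s) (aval e2 s)"
| "eval (c1 ;; c2) s = eval c2 (eval c1 s)"
| "eval (IF b c1 c2) s = (if bval b s then eval c1 s else eval c2 s)"
| "eval (FOR v p c) s = upd (loop (eval c) v (s par p) s) v 0 (s par p)"

primrec writes :: "lcom \<Rightarrow> arr set" where
  "writes NOP = {}"
| "writes (ASSIGN a e1 e2) = {a}"
| "writes (c1 ;; c2) = writes c1 \<union> writes c2"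
| "writes (IF b c1 c2) = writes c1 \<union> writes c2"
| "writes (FOR v p c) = insert v (writes c)"

text \<open>The conditions on \<open>FOR\<close> fix the number of passes at loop entry: the body
  can change neither its counter nor any loop bound.\<close>

primrec wf_loops :: "lcom \<Rightarrow> bool" where
  "wf_loops NOP \<longleftrightarrow> True"
| "wf_loops (ASSIGN a e1 e2) \<longleftrightarrow> True"
| "wf_loops (c1 ;; c2) \<longleftrightarrow> wf_loops c1 \<and> wf_loops c2"
| "wf_loops (IF b c1 c2) \<longleftrightarrow> wf_loops c1 \<and> wf_loops c2"
| "wf_loops (FOR v p c) \<longleftrightarrow> v \<notin> writes c \<and> v \<noteq> par \<and> par \<notin> writes c \<and> wf_loops c"

text \<open>The indeterminate stands for a common bound on the cells of \<open>par\<close>. Around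
  the body, a pass costs 4 steps: the test, the increment and two removals of \<open>Skip\<close>.
  The remaining 3 are the initialisation, one removal of \<open>Skip\<close> and the failing
  test.\<close>

primrec time_poly :: "lcom \<Rightarrow> nat poly" where
  "time_poly NOP = 0"
| "time_poly (ASSIGN a e1 e2) = 1"
| "time_poly (c1 ;; c2) = time_poly c1 + 1 + time_poly c2"
| "time_poly (IF b c1 c2) = 1 + time_poly c1 + time_poly c2"
| "time_poly (FOR v p c) = [:3:] + [:0, 1:] * (time_poly c + [:4:])"

definition timed :: "nat \<Rightarrow> lcom \<Rightarrow> store \<Rightarrow> bool" where
  "timed B c s \<longleftrightarrow> (\<exists>n \<le> poly (time_poly c) B. steps n (compile c) s Skip (eval c s))"

lemma upd_same [simp]: "upd s a i v a = (s a)(i := v)"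
  by (simp add: upd_def)

lemma upd_other [simp]: "b \<noteq> a \<Longrightarrow> upd s a i v b = s b"
  by (simp add: upd_def)

lemma upd_upd [simp]: "upd (upd s a i v) a i w = upd s a i w"
  by (simp add: upd_def)

lemma loop_frame:
  assumes "\<And>s. f s a = s a" "a \<noteq> v"
  shows "loop f v n s a = s a"
  using assms by (induction n) auto

lemma eval_frame: "a \<notin> writes c \<Longrightarrow> eval c s a = s a"
  by (induction c arbitrary: s) (auto simp: loop_frame)

lemma timed_Seq: "timed B c1 s \<Longrightarrow> timed B c2 (eval c1 s) \<Longrightarrow> timed B (c1 ;; c2) s"
  unfolding timed_def
  by (elim exE conjE, rule exI, rule conjI[rotated], simp, rule steps_Seq_Skip, assumption+) simp

lemma timed_ASSIGN: "timed B (ASSIGN a e1 e2) s"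
  unfolding timed_def by (rule exI[of _ 1]) (auto intro!: steps_1[simplified])

lemma timed_wf:
  assumes "wf_loops c" "par \<notin> writes c" "\<And>p. s par p \<le> B"
  shows "timed B c s"
  using assms
proof (induction c arbitrary: s)
  case NOP
  then show ?case by (auto simp: timed_def intro: steps_0)
next
  case (ASSIGN a e1 e2)
  show ?case by (rule timed_ASSIGN)
next
  case (SEQ c1 c2)
  then show ?case by (intro timed_Seq) (auto simp: eval_frame)
next
  case (IF b c1 c2)
  let ?c = "if bval b s then c1 else c2"
  have "timed B ?c s" using IF by auto
  then obtain n where n: "n \<le> poly (time_poly ?c) B" "steps n (compile ?c) s Skip (eval ?c s)"
    by (auto simp: timed_def)
  have "steps 1 (compile (IF b c1 c2)) s (compile ?c) s"
    by (rule steps_1) auto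
  from steps_trans[OF this n(2)]
  have "steps (1 + n) (compile (IF b c1 c2)) s Skip (eval (IF b c1 c2) s)"
    by (simp split: if_splits)
  then show ?case using n(1) by (auto simp: timed_def intro!: exI[of _ "1 + n"] split: if_splits)
next
  case (FOR v p c)
  let ?f = "eval c" and ?T = "poly (time_poly c) B"
  let ?b = "BLess (Load v (Const 0)) (Load par (Const p))"
  let ?inc = "Store v (Const 0) (Plus (Load v (Const 0)) (Const 1))"
  let ?w = "While ?b (Seq (compile c) ?inc)"
  let ?s = "\<lambda>i. upd (loop ?f v i s) v 0 i"
  have par: "loop ?f v i s par = s par" for i
    using FOR.prems by (intro loop_frame) (auto simp: eval_frame)
  have "\<exists>n \<le> i * (?T + 4). steps n ?w (?s 0) ?w (?s i)" if "i \<le> s par p" for i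
    using that
  proof (induction i)
    case 0
    then show ?case by (auto intro: steps_0)
  next
    case (Suc i)
    then obtain n where n: "n \<le> i * (?T + 4)" "steps n ?w (?s 0) ?w (?s i)" by auto
    have "timed B c (?s i)"
      using FOR.prems by (intro FOR.IH) (auto simp: par)
    then obtain n' where n': "n' \<le> ?T" "steps n' (compile c) (?s i) Skip (eval c (?s i))"
      by (auto simp: timed_def)
    have v: "eval c (?s i) v 0 = i" using FOR.prems by (simp add: eval_frame)
    have 1: "steps 1 ?w (?s i) (Seq (Seq (compile c) ?inc) ?w) (?s i)"
      using Suc.prems FOR.prems by (intro steps_1) (auto simp: par)
    have 2: "steps 1 ?inc (eval c (?s i)) Skip (?s (Suc i))"
      by (rule steps_1) (auto simp: v)
    have 3: "steps (n' + 1 + 1 + 1 + 0) (Seq (Seq (compile c) ?inc) ?w) (?s i) ?w (?s (Suc i))"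
      by (intro steps_Seq_Skip[OF steps_Seq_Skip[OF n'(2) 2]] steps_0)
    have "steps (n + (1 + (n' + 1 + 1 + 1 + 0))) ?w (?s 0) ?w (?s (Suc i))"
      by (intro steps_trans[OF n(2) steps_trans[OF 1 3]])
    moreover have "n + (1 + (n' + 1 + 1 + 1 + 0)) \<le> Suc i * (?T + 4)"
      using n(1) n'(1) by simp
    ultimately show ?case by blast
  qed
  from this[of "s par p"] obtain n where
    n: "n \<le> s par p * (?T + 4)" "steps n ?w (?s 0) ?w (?s (s par p))" by auto
  have 1: "steps 1 (Store v (Const 0) (Const 0)) s Skip (?s 0)"
    by (rule steps_1) auto
  have 2: "steps 1 ?w (?s (s par p)) Skip (?s (s par p))"
    using FOR.prems by (intro steps_1) (auto simp: par)
  have "steps (1 + 1 + (n + 1)) (compile (FOR v p c)) s Skip (eval (FOR v p c) s)"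
    using steps_Seq_Skip[OF 1 steps_trans[OF n(2) 2]] by simp
  moreover have "s par p * (?T + 4) \<le> B * (?T + 4)"
    using FOR.prems by (intro mult_right_mono) auto
  hence "1 + 1 + (n + 1) \<le> poly (time_poly (FOR v p c)) B"
    using n(1) by (simp add: algebra_simps)
  ultimately show ?case unfolding timed_def by blast
qed

text \<open>\<open>indep\<close> makes the invariant blind to the counter cell, which is rewritten
  before each pass and at the end. The last premise of \<open>body\<close> hands over the frame, so
  that \<open>I\<close> need not list unchanged arrays.\<close>

lemma FOR_rule:
  assumes wf: "v \<notin> writes c" "par \<notin> writes c" "v \<noteq> par"
    and n: "s par p = n"
    and init: "I 0 s"
    and indep: "\<And>i s' x. I i s' \<Longrightarrow> I i (upd s' v 0 x)"
    and body: "\<And>i s'. i < n \<Longrightarrow> I i s' \<Longrightarrow> s' v 0 = i \<Longrightarrow>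
      (\<And>a. a \<notin> writes c \<Longrightarrow> a \<noteq> v \<Longrightarrow> s' a = s a) \<Longrightarrow> I (Suc i) (eval c s')"
  shows "I n (eval (FOR v p c) s)"
proof -
  have "I i (loop (eval c) v i s)" if "i \<le> n" for i
    using that
  proof (induction i)
    case 0
    then show ?case using init by simp
  next
    case (Suc i)
    have "loop (eval c) v i s a = s a" if "a \<notin> writes c" "a \<noteq> v" for a
      using that by (intro loop_frame) (auto simp: eval_frame)
    then show ?case using Suc by (auto intro!: body indep)
  qed
  then show ?thesis by (auto simp: n intro: indep)
qed

section \<open>The program\<close>

text \<open>
  The cells of \<open>par\<close> hold \<open>m\<close>, \<open>m + 1\<close>, \<open>k\<close>, \<open>K + 1\<close> with \<open>K = k * a m\<close>, the number \<open>R\<close> of steps, \<open>2 * m\<close> and \<open>k + 1\<close>.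
  As there is no multiplication, \<open>rowS\<close> and \<open>rowV\<close> tabulate the multiples of the row lengths \<open>m + 1\<close>
  and \<open>K + 1\<close> of the matrices.
\<close>

abbreviation "rowS \<equiv> Work 13"
abbreviation "rowV \<equiv> Work 2"
abbreviation "acc \<equiv> Work 3"
abbreviation "smax \<equiv> Work 4"
abbreviation "best \<equiv> Work 5"
abbreviation "vtau \<equiv> Work 6"
abbreviation "vq \<equiv> Work 7"
abbreviation "vt \<equiv> Work 8"
abbreviation "vx \<equiv> Work 9"
abbreviation "vy \<equiv> Work 10"
abbreviation "vz \<equiv> Work 11"
abbreviation "pw \<equiv> Work 12"
abbreviation "arrF \<equiv> Work 14"
abbreviation "arrS \<equiv> Work 15"
abbreviation "vr \<equiv> Work 16"
abbreviation "vi \<equiv> Work 17"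
abbreviation "vi' \<equiv> Work 18"
abbreviation "arrRank \<equiv> Work 20"
abbreviation "mx \<equiv> Work 21"
abbreviation "vv \<equiv> Work 23"
abbreviation "vj \<equiv> Work 24"
abbreviation "pos \<equiv> Work 25"
abbreviation "wt \<equiv> Work 26"
abbreviation "arrC \<equiv> Work 27"
abbreviation "vb \<equiv> Work 28"
abbreviation "arrV \<equiv> Work 29"
abbreviation "arrArg \<equiv> Work 30"
abbreviation "low \<equiv> Work 31"
abbreviation "arg \<equiv> Work 32"
abbreviation "bud \<equiv> Work 33"
abbreviation "bestval \<equiv> Work 34"
abbreviation "besti \<equiv> Work 35"
abbreviation "arrCol \<equiv> Work 36"

abbreviation X :: "arr \<Rightarrow> aexp" where "X a \<equiv> Load a (Const 0)"
abbreviation param :: "nat \<Rightarrow> aexp" where "param p \<equiv> Load par (Const p)"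
abbreviation SET :: "arr \<Rightarrow> aexp \<Rightarrow> lcom" where "SET a e \<equiv> ASSIGN a (Const 0) e"
abbreviation ADD :: "arr \<Rightarrow> aexp \<Rightarrow> lcom" where "ADD a e \<equiv> SET a (Plus (X a) e)"
abbreviation atS :: "arr \<Rightarrow> aexp \<Rightarrow> aexp" where "atS a e \<equiv> Load a (Plus (Load rowS (X vr)) e)"

declare eval.simps(5) [simp del]

locale ucm =
  fixes m k :: nat and a \<sigma> :: "nat \<Rightarrow> nat"
  assumes m_pos: "1 \<le> m" and mono: "mono_on {0..m} a"
begin

definition "K = k * a m"
definition "R = 3 * k * m * m"
definition "sm = (MAX i\<in>{1..m}. \<sigma> i)"

definition env :: "store \<Rightarrow> bool" where
  "env s \<longleftrightarrow> s par 0 = m \<and> s par (Suc 0) = Suc m \<and> s par 2 = k \<and> s par 3 = Suc K \<and> s par 4 = R \<and>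
     s par 5 = 2 * m \<and> s par 6 = Suc k \<and>
     (\<forall>r\<le>k. s rowS r = r * Suc m) \<and> (\<forall>r\<le>k. s rowV r = r * Suc K) \<and>
     (\<forall>i\<le>m. s (Input 1) i = a i) \<and> (\<forall>i\<le>m. s (Input 2) i = \<sigma> i) \<and> s smax 0 = sm"

definition "env_arrs = {par, rowS, rowV, Input 1, Input 2, smax}"

lemma env_cong: "(\<And>a. a \<in> env_arrs \<Longrightarrow> s' a = s a) \<Longrightarrow> env s' \<longleftrightarrow> env s"
  by (simp add: env_def env_arrs_def)

lemma env_simps [simp]:
  assumes "env s"
  shows "s par 0 = m" "s par (Suc 0) = Suc m" "s par 2 = k" "s par 3 = Suc K" "s par 4 = R"
    "s par 5 = 2 * m" "s par 6 = Suc k" "r \<le> k \<Longrightarrow> s rowS r = r * Suc m" "r \<le> k \<Longrightarrow> s rowV r = r * Suc K"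
    "i \<le> m \<Longrightarrow> s (Input (Suc 0)) i = a i" "i \<le> m \<Longrightarrow> s (Input 2) i = \<sigma> i" "s smax 0 = sm"
  using assms by (simp_all add: env_def)

lemma env_upd [simp]: "b \<notin> env_arrs \<Longrightarrow> env (upd s b i v) \<longleftrightarrow> env s"
  by (rule env_cong) (metis upd_other)

lemma env_eval [simp]: "writes c \<inter> env_arrs = {} \<Longrightarrow> env (eval c s) \<longleftrightarrow> env s"
  by (rule env_cong) (metis disjoint_iff eval_frame)

end

section \<open>Integer powers for the potential\<close>

definition "mul_q = (SET acc (Const 0) ;;
  FOR vz 0 (IF (BLess (X vz) (Plus (X vq) (Const 1))) (ADD acc (X pw)) NOP))"

text \<open>Of the \<open>2 * m\<close> passes, those with \<open>vy < vx\<close> multiply by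
  \<open>q + 1\<close> and the others by \<open>q\<close>, which yields \<open>weight q vx\<close>;
  \<open>vq\<close> holds \<open>q - 1\<close>.\<close>

definition "pow_entry = (SET pw (Const 1) ;;
  FOR vy 5 (mul_q ;; IF (BLess (X vy) (X vx)) (ADD acc (X pw)) NOP ;; SET pw (X acc)))"

definition "pow_table = FOR vx 5 (pow_entry ;; ASSIGN arrF (X vx) (X pw))"

lemma writes_mul_q [simp]: "writes mul_q = {acc, vz}" and wf_mul_q [simp]: "wf_loops mul_q"
  by (auto simp: mul_q_def)
lemma writes_pow_entry [simp]: "writes pow_entry = {acc, vz, vy, pw}" and wf_pow_entry [simp]: "wf_loops pow_entry"
  by (auto simp: pow_entry_def)
lemma writes_pow_table [simp]: "writes pow_table = {acc, vz, vy, pw, vx, arrF}" and wf_pow_table [simp]: "wf_loops pow_table"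
  by (auto simp: pow_table_def)

text \<open>The frame given to \<open>body\<close> leaves out \<open>A\<close>: an entry may be
  computed from arrays that the loop does not change, but not from entries written by earlier
  passes.\<close>

lemma FOR_fill:
  assumes wf: "v \<notin> writes c" "par \<notin> writes c" "v \<noteq> par" "A \<notin> writes c" "A \<noteq> v" "A \<noteq> par"
    and n: "s par p = n"
    and body: "\<And>i s'. i < n \<Longrightarrow> s' v 0 = i \<Longrightarrow>
      (\<And>b. b \<notin> writes c \<Longrightarrow> b \<noteq> v \<Longrightarrow> b \<noteq> A \<Longrightarrow> s' b = s b) \<Longrightarrow>
      aval e1 (eval c s') = d + i \<and> aval e2 (eval c s') = f i"
  shows "eval (FOR v p (c ;; ASSIGN A e1 e2)) s A = (\<lambda>x. if d \<le> x \<and> x < d + n then f (x - d) else s A x)"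
    (is "?s A = _")
proof -
  have "\<forall>x. ?s A x = (if d \<le> x \<and> x < d + n then f (x - d) else s A x)"
  proof (rule FOR_rule[where I = "\<lambda>n s'. \<forall>x. s' A x = (if d \<le> x \<and> x < d + n then f (x - d) else s A x)"])
    fix i s'
    assume i: "i < n" and I: "\<forall>x. s' A x = (if d \<le> x \<and> x < d + i then f (x - d) else s A x)"
      and v: "s' v 0 = i"
      and fr: "\<And>a. a \<notin> writes (c ;; ASSIGN A e1 e2) \<Longrightarrow> a \<noteq> v \<Longrightarrow> s' a = s a"
    have "aval e1 (eval c s') = d + i \<and> aval e2 (eval c s') = f i"
      using i v fr by (intro body) auto
    then show "\<forall>x. eval (c ;; ASSIGN A e1 e2) s' A x =
         (if d \<le> x \<and> x < d + Suc i then f (x - d) else s A x)"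
      using I wf by (auto simp: eval_frame)
  qed (use wf n in auto)
  then show ?thesis by auto
qed

text \<open>The stride \<open>D\<close> may exceed the row width \<open>w\<close>: the cost table
  has rows of \<open>m\<close> entries at stride \<open>m + 1\<close>.\<close>

lemma FOR_fill_rows:
  assumes wf: "v \<notin> writes c" "par \<notin> writes c" "v \<noteq> par" "A \<noteq> v"
    and n: "s par p = n" and D: "w \<le> D"
    and body: "\<And>r s'. r < n \<Longrightarrow> s' v 0 = r \<Longrightarrow>
      (\<And>b. b \<notin> writes c \<Longrightarrow> b \<noteq> v \<Longrightarrow> s' b = s b) \<Longrightarrow>
      eval c s' A = (\<lambda>x. if r * D \<le> x \<and> x < r * D + w then f r (x - r * D) else s' A x)"
  shows "\<forall>r<n. \<forall>j<w. eval (FOR v p c) s A (r * D + j) = f r j"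
proof (rule FOR_rule[where I = "\<lambda>n s'. \<forall>r<n. \<forall>j<w. s' A (r * D + j) = f r j"])
  fix i s'
  assume i: "i < n" and I: "\<forall>r<i. \<forall>j<w. s' A (r * D + j) = f r j" and v: "s' v 0 = i"
    and fr: "\<And>b. b \<notin> writes c \<Longrightarrow> b \<noteq> v \<Longrightarrow> s' b = s b"
  have "r * D + j < i * D" if "r < i" "j < w" for r j
  proof -
    have "r * D + j < Suc r * D" using that D by simp
    also have "\<dots> \<le> i * D" using that by (intro mult_right_mono) auto
    finally show ?thesis .
  qed
  then show "\<forall>r<Suc i. \<forall>j<w. eval c s' A (r * D + j) = f r j"
    using I by (auto simp: body[OF i v fr] less_Suc_eq) (metis not_le)
qed (use wf n in auto)

lemma card_less_Suc: "card {i. i < Suc n \<and> P i} = card {i. i < n \<and> P i} + of_bool (P n)"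
proof -
  have "{i. i < Suc n \<and> P i} = {i. i < n \<and> P i} \<union> (if P n then {n} else {})"
    by (auto simp: less_Suc_eq)
  then show ?thesis by simp
qed

section \<open>Initial matrix, sorting of the rows and scoring\<close>

definition "init_row = FOR vi 1 (IF (BLess (X vi) (Const 1)) (SET acc (param 0)) (SET acc (Const 0)) ;;
  ASSIGN arrS (Plus (Load rowS (X vr)) (X vi)) (X acc))"
definition "init_S = FOR vr 2 init_row"

text \<open>Lexicographic order of (index, candidate), written with the available connectives:
  \<open>vi'\<close> precedes \<open>vi\<close> if its index is smaller, or not larger while
  \<open>vi' < vi\<close>.\<close>

definition "before = BNot (BAnd (BNot (BLess (atS arrS (X vi')) (atS arrS (X vi))))
  (BNot (BAnd (BNot (BLess (atS arrS (X vi)) (atS arrS (X vi')))) (BLess (X vi') (X vi)))))"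
definition "rank_count = (SET acc (Const 0) ;; FOR vi' 1 (IF before (ADD acc (Const 1)) NOP))"
definition "rank_row = FOR vi 1 (rank_count ;; ASSIGN arrRank (Plus (Load rowS (X vr)) (X vi)) (X acc))"
definition "rank_all = FOR vr 2 rank_row"

definition "score_one = (SET acc (Load (Input 2) (Plus (X vi) (Const 1))) ;;
  FOR vr 2 (ADD acc (Load (Input 1) (atS arrRank (Plus (X vi) (Const 1))))))"
definition "score_max = (SET mx (Const 0) ;;
  FOR vi 0 (score_one ;; IF (BLess (X mx) (X acc)) (SET mx (X acc)) NOP))"

definition "copy_row = FOR vi 1 (NOP ;; ASSIGN Output (Plus (Load rowS (X vr)) (X vi)) (atS arrRank (X vi)))"
definition "copy_all = FOR vr 2 copy_row"
definition "evaluate = (rank_all ;; score_max ;; IF (BLess (X mx) (X best)) (SET best (X mx) ;; copy_all) NOP)"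

lemma writes_init_row [simp]: "writes init_row = {vi, acc, arrS}" and wf_init_row [simp]: "wf_loops init_row"
  by (auto simp: init_row_def)
lemma writes_init_S [simp]: "writes init_S = {vr, vi, acc, arrS}" and wf_init_S [simp]: "wf_loops init_S"
  by (auto simp: init_S_def)
lemma writes_rank_count [simp]: "writes rank_count = {acc, vi'}" and wf_rank_count [simp]: "wf_loops rank_count"
  by (auto simp: rank_count_def)
lemma writes_rank_row [simp]: "writes rank_row = {acc, vi', vi, arrRank}" and wf_rank_row [simp]: "wf_loops rank_row"
  by (auto simp: rank_row_def)
lemma writes_rank_all [simp]: "writes rank_all = {acc, vi', vi, vr, arrRank}" and wf_rank_all [simp]: "wf_loops rank_all"
  by (auto simp: rank_all_def)
lemma writes_score_one [simp]: "writes score_one = {acc, vr}" and wf_score_one [simp]: "wf_loops score_one"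
  by (auto simp: score_one_def)
lemma writes_score_max [simp]: "writes score_max = {acc, vr, vi, mx}" and wf_score_max [simp]: "wf_loops score_max"
  by (auto simp: score_max_def)
lemma writes_copy_row [simp]: "writes copy_row = {vi, Output}" and wf_copy_row [simp]: "wf_loops copy_row"
  by (auto simp: copy_row_def)
lemma writes_copy_all [simp]: "writes copy_all = {vr, vi, Output}" and wf_copy_all [simp]: "wf_loops copy_all"
  by (auto simp: copy_all_def)
lemma writes_evaluate [simp]: "writes evaluate = {acc, vi', vi, vr, arrRank, mx, best, Output}"
  and wf_evaluate [simp]: "wf_loops evaluate"
  by (auto simp: evaluate_def)

context ucm begin

text \<open>The loop length must be a cell of \<open>par\<close>, so all \<open>m\<close> passes are
  made and the guard lets \<open>vq + 1\<close> of them add; \<open>vq < m\<close> ensures that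
  there are enough.\<close>

lemma mul_q:
  assumes "env s" "s vq 0 < m"
  shows "eval mul_q s acc 0 = Suc (s vq 0) * s pw 0"
proof -
  have "eval mul_q s acc 0 = min m (Suc (s vq 0)) * s pw 0"
    unfolding mul_q_def eval.simps(3)
    by (rule FOR_rule[where I = "\<lambda>n s'. s' acc 0 = min n (Suc (s vq 0)) * s pw 0"])
       (use assms in auto)
  with assms show ?thesis by (simp add: min_absorb2 Suc_leI del: mult_Suc)
qed

lemma pow_entry:
  assumes "env s" "s vq 0 < m" "s vx 0 < 2 * m"
  shows "eval pow_entry s pw 0 = Suc (Suc (s vq 0)) ^ s vx 0 * Suc (s vq 0) ^ (2 * m - s vx 0)"
proof -
  define q where "q = Suc (s vq 0)"
  have "env (eval pow_entry s) \<and> eval pow_entry s pw 0 = Suc q ^ min (2 * m) (s vx 0) * q ^ (2 * m - s vx 0)"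
    unfolding pow_entry_def eval.simps(3)
  proof (rule FOR_rule[where I = "\<lambda>n s'. env s' \<and> s' pw 0 = Suc q ^ min n (s vx 0) * q ^ (n - s vx 0)"],
      goal_cases)
    case (7 i s')
    have fr: "s' vq = s vq" "s' vx = s vx" using 7(4) by auto
    have "eval mul_q s' acc 0 = q * s' pw 0"
      using 7 assms by (subst mul_q) (auto simp: fr q_def)
    then show ?case
      using 7 by (cases "i < s vx 0") (auto simp: env_arrs_def eval_frame fr Suc_diff_le)
  qed (use assms in \<open>auto simp: env_arrs_def\<close>)
  with assms show ?thesis by (simp add: min_def q_def)
qed

lemma pow_table:
  assumes "env s" "s vq 0 < m" "x < 2 * m"
  shows "eval pow_table s arrF x = Suc (Suc (s vq 0)) ^ x * Suc (s vq 0) ^ (2 * m - x)"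
proof -
  define q where "q = Suc (s vq 0)"
  have "env (eval pow_table s) \<and> (\<forall>x<2*m. eval pow_table s arrF x = Suc q ^ x * q ^ (2 * m - x))"
    unfolding pow_table_def
    by (rule FOR_rule[where I = "\<lambda>n s'. env s' \<and> (\<forall>x<n. s' arrF x = Suc q ^ x * q ^ (2 * m - x))"])
       (use assms in \<open>auto simp: env_arrs_def pow_entry eval_frame less_Suc_eq q_def\<close>)
  with assms show ?thesis by (simp add: q_def)
qed

definition "tbl A r i = (A (r * Suc m + i) :: nat)"

text \<open>Zero columns spend nothing of any budget, hence are feasible for every guess. Index
  \<open>m\<close> exceeds all indices that a move can set, so sorting always gives candidate 0 the
  top score.\<close>

definition "start = (\<lambda>r i. if i = 0 then m else 0 :: nat)"

lemma init_S:
  assumes "env s" "r < k" "i \<le> m"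
  shows "tbl (eval init_S s arrS) r i = start r i"
proof -
  have "\<forall>r<k. \<forall>i<Suc m. eval init_S s arrS (r * Suc m + i) = start r i"
    unfolding init_S_def
  proof (rule FOR_fill_rows)
    fix r s' assume r: "r < k" "s' vr 0 = r"
      and fr: "\<And>b. b \<notin> writes init_row \<Longrightarrow> b \<noteq> vr \<Longrightarrow> s' b = s b"
    show "eval init_row s' arrS =
       (\<lambda>x. if r * Suc m \<le> x \<and> x < r * Suc m + Suc m then start r (x - r * Suc m) else s' arrS x)"
      unfolding init_row_def
      by (rule FOR_fill) (use assms(1) r fr in \<open>auto simp: start_def\<close>)
  qed (use assms in auto)
  then show ?thesis using assms by (simp add: tbl_def del: mult_Suc_right)
qed

text \<open>Position of \<open>i\<close> when row \<open>r\<close> is sorted by index, ties broken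
  by candidate number; this rounds an arbitrary row to a permutation.\<close>

definition srank :: "(nat \<Rightarrow> nat \<Rightarrow> nat) \<Rightarrow> nat \<Rightarrow> nat \<Rightarrow> nat" where
  "srank S r i = card {i'. i' < Suc m \<and> (S r i' < S r i \<or> S r i' = S r i \<and> i' < i)}"

lemma rank_count:
  assumes "env s" "s vr 0 < k"
  shows "eval rank_count s acc 0 = srank (tbl (s arrS)) (s vr 0) (s vi 0)"
proof -
  let ?I = "\<lambda>n s'. s' acc 0 =
        card {i'. i' < n \<and> (tbl (s arrS) (s vr 0) i' < tbl (s arrS) (s vr 0) (s vi 0) \<or>
          tbl (s arrS) (s vr 0) i' = tbl (s arrS) (s vr 0) (s vi 0) \<and> i' < s vi 0)}"
  have "?I (Suc m) (eval rank_count s)"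
    unfolding rank_count_def eval.simps(3)
  proof (rule FOR_rule[where I = ?I], goal_cases)
    case (7 i s')
    have fr: "s' b = s b" if "b \<notin> {acc, vi'}" for b
      using 7(4)[of b] that by auto
    have t: "s' arrS (s' rowS (s' vr 0) + x) = tbl (s arrS) (s vr 0) x" for x
      using assms by (simp add: fr tbl_def)
    have "bval before s' \<longleftrightarrow> (tbl (s arrS) (s vr 0) i < tbl (s arrS) (s vr 0) (s vi 0) \<or>
          tbl (s arrS) (s vr 0) i = tbl (s arrS) (s vr 0) (s vi 0) \<and> i < s vi 0)"
      by (simp add: before_def t 7(3)) (auto simp: fr)
    then show ?case
      using 7(2) by (simp add: card_less_Suc)
  qed (use assms in auto)
  then show ?thesis by (simp add: srank_def)
qed

lemma rank_all:
  assumes "env s" "r < k" "i \<le> m"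
  shows "tbl (eval rank_all s arrRank) r i = srank (tbl (s arrS)) r i"
proof -
  have "\<forall>r<k. \<forall>i<Suc m. eval rank_all s arrRank (r * Suc m + i) = srank (tbl (s arrS)) r i"
    unfolding rank_all_def
  proof (rule FOR_fill_rows)
    fix r s' assume r: "r < k" "s' vr 0 = r"
      and fr: "\<And>b. b \<notin> writes rank_row \<Longrightarrow> b \<noteq> vr \<Longrightarrow> s' b = s b"
    show "eval rank_row s' arrRank =
       (\<lambda>x. if r * Suc m \<le> x \<and> x < r * Suc m + Suc m then srank (tbl (s arrS)) r (x - r * Suc m) else s' arrRank x)"
      unfolding rank_row_def
    proof (rule FOR_fill)
      fix i s'' assume i: "i < Suc m" "s'' vi 0 = i"
        and fr': "\<And>b. b \<notin> writes rank_count \<Longrightarrow> b \<noteq> vi \<Longrightarrow> b \<noteq> arrRank \<Longrightarrow> s'' b = s' b"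
      have e: "env s''" using assms(1) by (subst env_cong[of s'' s]) (auto simp: env_arrs_def fr fr')
      show "aval (Plus (Load rowS (X vr)) (X vi)) (eval rank_count s'') = r * Suc m + i \<and>
        aval (X acc) (eval rank_count s'') = srank (tbl (s arrS)) r i"
        using i r e env_simps(8)[OF e] by (auto simp: rank_count fr fr' eval_frame)
    qed (use assms r fr in \<open>auto\<close>)
  qed (use assms in auto)
  then show ?thesis using assms by (simp add: tbl_def del: mult_Suc_right)
qed

lemma score_one:
  assumes "env s" "s vi 0 < m" "\<And>r. r < k \<Longrightarrow> tbl (s arrRank) r (Suc (s vi 0)) \<le> m"
  shows "eval score_one s acc 0 = score a \<sigma> k (tbl (s arrRank)) (Suc (s vi 0))"
proof -
  let ?I = "\<lambda>n s'. s' acc 0 = \<sigma> (Suc (s vi 0)) + (\<Sum>r<n. a (tbl (s arrRank) r (Suc (s vi 0))))"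
  have "?I k (eval score_one s)"
    unfolding score_one_def eval.simps(3)
  proof (rule FOR_rule[where I = ?I], goal_cases)
    case (7 r s')
    have fr: "s' b = s b" if "b \<notin> {acc, vr}" for b
      using 7(4)[of b] that by auto
    have "s' arrRank (s' rowS (s' vr 0) + Suc (s vi 0)) = tbl (s arrRank) r (Suc (s vi 0))"
      using assms 7 by (simp add: fr tbl_def)
    then show ?case
      using 7(1,2) assms by (simp add: fr)
  qed (use assms in auto)
  then show ?thesis by (simp add: score_def)
qed

text \<open>The inserted 0 gives the maximum over the empty prefix a value, matching the initial
  \<open>mx = 0\<close>; it does not change a maximum of naturals over a nonempty range.\<close>

lemma Max_insert_0_lessThan_Suc:
  "Max (insert 0 (f ` {..<Suc n})) = max (Max (insert 0 (f ` {..<n}))) (f n :: nat)"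
proof -
  have 1: "insert 0 (f ` {..<Suc n}) = insert (f n) (insert 0 (f ` {..<n}))"
    by (auto simp: lessThan_Suc)
  show ?thesis
    unfolding 1 max.commute[of _ "f n"] by (rule Max_insert) auto
qed

lemma Max_insert_0_Suc:
  "Max (insert 0 ((\<lambda>i. f (Suc i)) ` {..<m})) = (MAX i\<in>{1..m}. f i :: nat)"
proof -
  have "f ` {1..m} = (\<lambda>i. f (Suc i)) ` {..<m}"
    unfolding image_Suc_lessThan[symmetric] by (simp add: image_image)
  then show ?thesis using m_pos by (subst Max_insert) auto
qed

lemma score_max:
  assumes "env s" "\<And>r i. r < k \<Longrightarrow> i \<le> m \<Longrightarrow> tbl (s arrRank) r i \<le> m"
  shows "eval score_max s mx 0 = max_score a m \<sigma> k (tbl (s arrRank))"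
proof -
  let ?f = "score a \<sigma> k (tbl (s arrRank))"
  let ?I = "\<lambda>n s'. s' mx 0 = Max (insert 0 ((\<lambda>i. ?f (Suc i)) ` {..<n}))"
  have "?I m (eval score_max s)"
    unfolding score_max_def eval.simps(3)
  proof (rule FOR_rule[where I = ?I], goal_cases)
    case (7 i s')
    have fr: "s' b = s b" if "b \<notin> {acc, vr, mx, vi}" for b
      using 7(4)[of b] that by auto
    have "env s'" using assms(1) by (subst env_cong[of s' s]) (auto simp: env_arrs_def fr)
    then have "eval score_one s' acc 0 = score a \<sigma> k (tbl (s' arrRank)) (Suc i)"
      using 7 assms fr by (subst score_one) auto
    also have "s' arrRank = s arrRank" by (simp add: fr)
    finally have sc: "eval score_one s' acc 0 = ?f (Suc i)" .
    have "eval score_one s' mx 0 = s' mx 0" by (simp add: eval_frame)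
    then show ?case
      unfolding Max_insert_0_lessThan_Suc 7(2)[symmetric] by (simp add: sc max_def)
  qed (use assms in auto)
  then show ?thesis
    by (simp only: Max_insert_0_Suc max_score_def)
qed

lemma copy_all:
  assumes "env s" "r < k" "i \<le> m"
  shows "tbl (eval copy_all s Output) r i = tbl (s arrRank) r i"
proof -
  have "\<forall>r<k. \<forall>i<Suc m. eval copy_all s Output (r * Suc m + i) = tbl (s arrRank) r i"
    unfolding copy_all_def
  proof (rule FOR_fill_rows)
    fix r s' assume r: "r < k" "s' vr 0 = r"
      and fr: "\<And>b. b \<notin> writes copy_row \<Longrightarrow> b \<noteq> vr \<Longrightarrow> s' b = s b"
    show "eval copy_row s' Output =
       (\<lambda>x. if r * Suc m \<le> x \<and> x < r * Suc m + Suc m then tbl (s arrRank) r (x - r * Suc m) else s' Output x)"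
      unfolding copy_row_def
      by (rule FOR_fill) (use assms(1) r fr in \<open>auto simp: tbl_def\<close>)
  qed (use assms in auto)
  then show ?thesis using assms by (simp add: tbl_def del: mult_Suc_right)
qed

end

section \<open>The best column move by a knapsack dynamic program\<close>

definition "row_pos = (SET pos (Minus (param 0) (Plus (X vj) (Const 1))) ;;
  FOR vi' 0 (IF (BAnd (BNot (BLess (X vi') (X vi))) (BNot (BLess (X vi) (X vi'))))
      (SET acc (X vv)) (SET acc (atS arrS (Plus (X vi') (Const 1)))) ;;
    IF (BLess (X vj) (X acc)) NOP (ADD pos (Const 1))))"
definition "row_wt = (SET wt (Const 0) ;; FOR vj 0 (row_pos ;; ADD wt (Load arrF (X pos))))"
definition "cost_row = FOR vv 0 (row_wt ;; ASSIGN arrC (Plus (Load rowS (X vr)) (X vv)) (X wt))"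
definition "cost_all = FOR vr 2 cost_row"

abbreviation "a0 \<equiv> Load (Input 1) (Const 0)"
abbreviation "av \<equiv> Load (Input 1) (X vv)"
abbreviation "dp_val \<equiv> Plus (Load arrV (Plus (Load rowV (X vr)) (Minus (Plus (X vb) a0) av))) (atS arrC (X vv))"

text \<open>Index 0 costs \<open>a 0 - a 0 = 0\<close>, so it is always affordable and can
  initialise the minimum; the budget it leaves is \<open>b\<close> itself.\<close>

definition "dp_entry = (SET arg (Const 0) ;;
  SET low (Plus (Load arrV (Plus (Load rowV (X vr)) (X vb))) (atS arrC (Const 0))) ;;
  FOR vv 0 (IF (BAnd (BNot (BLess (Plus (X vb) a0) av)) (BLess dp_val (X low)))
    (SET low dp_val ;; SET arg (X vv)) NOP))"
definition "dp_row = FOR vb 3 (dp_entry ;; ASSIGN arrArg (Plus (Load rowV (X vr)) (X vb)) (X arg) ;;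
  ASSIGN arrV (Plus (Load rowV (Plus (X vr) (Const 1))) (X vb)) (X low))"
definition "dp_init = FOR vb 3 (NOP ;; ASSIGN arrV (X vb) (Const 0))"
definition "dp_all = (dp_init ;; FOR vr 2 dp_row)"

text \<open>Traceback: \<open>vr\<close> counts up while the row \<open>k - (vr + 1)\<close> in
  \<open>acc\<close> goes down, since the choice in a row depends on the budget that the later rows
  have left.\<close>

definition "walk = FOR vr 2 (SET acc (Minus (param 2) (Plus (X vr) (Const 1))) ;;
  SET arg (Load arrArg (Plus (Load rowV (X acc)) (X bud))) ;;
  ASSIGN arrCol (X acc) (X arg) ;;
  SET bud (Minus (Plus (X bud) a0) (Load (Input 1) (X arg))))"

text \<open>The table covers budgets up to \<open>K\<close>; cutting larger ones to \<open>K\<close>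
  loses nothing, as no column can cost more than \<open>k * a m\<close>.\<close>

definition "set_bud = (SET bud (Minus (Plus (X vtau) (X smax)) (Load (Input 2) (Plus (X vi) (Const 1)))) ;;
  IF (BLess (X bud) (param 3)) NOP (SET bud (Minus (param 3) (Const 1))))"

abbreviation "opt_val \<equiv> Load arrV (Plus (Load rowV (param 2)) (X bud))"

text \<open>For \<open>vi = 0\<close> the column is taken unconditionally, which discards the
  \<open>bestval\<close> left by the previous move.\<close>

definition "try_col = (cost_all ;; dp_all ;; set_bud ;;
  IF (BAnd (BNot (BLess (X vi) (Const 1))) (BNot (BLess opt_val (X bestval)))) NOP
    (SET bestval opt_val ;; SET besti (X vi) ;; walk))"

definition "put_col = FOR vr 2 (ASSIGN arrS (Plus (Load rowS (X vr)) (Plus (X besti) (Const 1))) (Load arrCol (X vr)))"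

definition "improve = (FOR vi 0 try_col ;; put_col)"

lemma writes_row_pos [simp]: "writes row_pos = {pos, vi', acc}" and wf_row_pos [simp]: "wf_loops row_pos"
  by (auto simp: row_pos_def)
lemma writes_row_wt [simp]: "writes row_wt = {pos, vi', acc, wt, vj}" and wf_row_wt [simp]: "wf_loops row_wt"
  by (auto simp: row_wt_def)
lemma writes_cost_row [simp]: "writes cost_row = {pos, vi', acc, wt, vj, vv, arrC}" and wf_cost_row [simp]: "wf_loops cost_row"
  by (auto simp: cost_row_def)
lemma writes_cost_all [simp]: "writes cost_all = {pos, vi', acc, wt, vj, vv, arrC, vr}" and wf_cost_all [simp]: "wf_loops cost_all"
  by (auto simp: cost_all_def)
lemma writes_dp_entry [simp]: "writes dp_entry = {low, arg, vv}" and wf_dp_entry [simp]: "wf_loops dp_entry"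
  by (auto simp: dp_entry_def)
lemma writes_dp_row [simp]: "writes dp_row = {low, arg, vv, vb, arrArg, arrV}" and wf_dp_row [simp]: "wf_loops dp_row"
  by (auto simp: dp_row_def)
lemma writes_dp_init [simp]: "writes dp_init = {vb, arrV}" and wf_dp_init [simp]: "wf_loops dp_init"
  by (auto simp: dp_init_def)
lemma writes_dp_all [simp]: "writes dp_all = {low, arg, vv, vb, arrArg, arrV, vr}" and wf_dp_all [simp]: "wf_loops dp_all"
  by (auto simp: dp_all_def)
lemma writes_walk [simp]: "writes walk = {vr, acc, arg, arrCol, bud}" and wf_walk [simp]: "wf_loops walk"
  by (auto simp: walk_def)
lemma writes_set_bud [simp]: "writes set_bud = {bud}" and wf_set_bud [simp]: "wf_loops set_bud"
  by (auto simp: set_bud_def)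
lemma writes_try_col [simp]:
    "writes try_col = {pos, vi', acc, wt, vj, vv, arrC, vr, low, arg, vb, arrArg, arrV, bud, bestval, besti, arrCol}"
  and wf_try_col [simp]: "wf_loops try_col"
  by (auto simp: try_col_def)
lemma writes_put_col [simp]: "writes put_col = {vr, arrS}" and wf_put_col [simp]: "wf_loops put_col"
  by (auto simp: put_col_def)
lemma writes_improve [simp]:
    "writes improve = {pos, vi', acc, wt, vj, vv, arrC, vr, low, arg, vb, arrArg, arrV, bud, bestval, besti, arrCol, vi, arrS}"
  and wf_improve [simp]: "wf_loops improve"
  by (auto simp: improve_def)

lemma row_major_inj:
  assumes "i < D" "i' < D"
  shows "r * D + i = r' * D + i' \<longleftrightarrow> r = r' \<and> i = (i' :: nat)"
proof
  assume eq: "r * D + i = r' * D + i'"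
  have "(r * D + i) div D = r" "(r' * D + i') div D = r'"
    using assms by simp_all
  then show "r = r' \<and> i = i'" using eq by auto
qed auto

context ucm begin

text \<open>
  Up to the factor \<open>q ^ (2 * m) * (1 + 1/q) ^ m\<close>, which makes it an integer, \<open>rowpot\<close> is the potential of a row:
  the exponent is the imbalance plus \<open>m\<close>.
\<close>

definition cnt :: "(nat \<Rightarrow> nat) \<Rightarrow> nat \<Rightarrow> nat" where
  "cnt f j = card {i. i < m \<and> f (Suc i) \<le> j}"

definition weight :: "nat \<Rightarrow> nat \<Rightarrow> nat" where
  "weight q x = Suc q ^ x * q ^ (2 * m - x)"

definition rowpot :: "nat \<Rightarrow> (nat \<Rightarrow> nat) \<Rightarrow> nat" where
  "rowpot q f = (\<Sum>j<m. weight q (m - Suc j + cnt f j))"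

lemma cnt_le: "cnt f j \<le> m"
  unfolding cnt_def by (rule order.trans[OF card_mono[of "{..<m}"]]) auto

text \<open>The entry of candidate \<open>vi + 1\<close> is read as \<open>vv\<close>, so the
  exponent is that of the row after the move, while \<open>arrS\<close> stays untouched.\<close>

lemma row_pos:
  assumes "env s" "s vr 0 < k"
  shows "eval row_pos s pos 0 =
    m - Suc (s vj 0) + cnt ((tbl (s arrS) (s vr 0))(Suc (s vi 0) := s vv 0)) (s vj 0)"
proof -
  let ?f = "(tbl (s arrS) (s vr 0))(Suc (s vi 0) := s vv 0)"
  let ?I = "\<lambda>n s'. s' pos 0 = m - Suc (s vj 0) + card {i. i < n \<and> ?f (Suc i) \<le> s vj 0}"
  have "?I m (eval row_pos s)"
    unfolding row_pos_def eval.simps(3)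
  proof (rule FOR_rule[where I = ?I], goal_cases)
    case (7 i s')
    have fr: "s' b = s b" if "b \<notin> {acc, vi', pos}" for b
      using 7(4)[of b] that by auto
    have t: "s' arrS (s' rowS (s' vr 0) + x) = tbl (s arrS) (s vr 0) x" for x
      using assms by (simp add: fr tbl_def)
    show ?case
      using 7(2) assms by (auto simp: card_less_Suc 7(3) fr[of vj] fr[of vv] fr[of vi] t[of "Suc i", simplified])
  qed (use assms in auto)
  then show ?thesis by (simp add: cnt_def)
qed

lemma row_wt:
  assumes "env s" "s vr 0 < k" "\<forall>x<2*m. s arrF x = weight q x"
  shows "eval row_wt s wt 0 = rowpot q ((tbl (s arrS) (s vr 0))(Suc (s vi 0) := s vv 0))"
proof -
  let ?f = "(tbl (s arrS) (s vr 0))(Suc (s vi 0) := s vv 0)"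
  let ?I = "\<lambda>n s'. s' wt 0 = (\<Sum>j<n. weight q (m - Suc j + cnt ?f j))"
  have "?I m (eval row_wt s)"
    unfolding row_wt_def eval.simps(3)
  proof (rule FOR_rule[where I = ?I], goal_cases)
    case (7 j s')
    have fr: "s' b = s b" if "b \<notin> {pos, vi', acc, wt, vj}" for b
      using 7(4)[of b] that by auto
    have e: "env s'" using assms(1) by (subst env_cong[of s' s]) (auto simp: env_arrs_def fr)
    have p: "eval row_pos s' pos 0 = m - Suc j + cnt ?f j"
      using assms 7(3) by (subst row_pos[OF e]) (auto simp: fr)
    have "m - Suc j + cnt ?f j < 2 * m"
      using 7(1) cnt_le[of ?f j] by linarith
    then show ?case
      using 7(2) assms(3) by (simp add: eval_frame p fr)
  qed (use assms in auto)
  then show ?thesis by (simp add: rowpot_def)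
qed

text \<open>A column move changes one entry in each row, so the new total potential is a sum of one
  table entry per row; this separability is what the knapsack recursion needs.\<close>

lemma cost_all:
  assumes "env s" "\<forall>x<2*m. s arrF x = weight q x" "r < k" "v < m"
  shows "tbl (eval cost_all s arrC) r v = rowpot q ((tbl (s arrS) r)(Suc (s vi 0) := v))"
proof -
  let ?f = "\<lambda>r v. rowpot q ((tbl (s arrS) r)(Suc (s vi 0) := v))"
  have "\<forall>r<k. \<forall>v<m. eval cost_all s arrC (r * Suc m + v) = ?f r v"
    unfolding cost_all_def
  proof (rule FOR_fill_rows)
    fix r s' assume r: "r < k" "s' vr 0 = r"
      and fr: "\<And>b. b \<notin> writes cost_row \<Longrightarrow> b \<noteq> vr \<Longrightarrow> s' b = s b"
    show "eval cost_row s' arrC =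
       (\<lambda>x. if r * Suc m \<le> x \<and> x < r * Suc m + m then ?f r (x - r * Suc m) else s' arrC x)"
      unfolding cost_row_def
    proof (rule FOR_fill)
      fix i s'' assume i: "i < m" "s'' vv 0 = i"
        and fr': "\<And>b. b \<notin> writes row_wt \<Longrightarrow> b \<noteq> vv \<Longrightarrow> b \<noteq> arrC \<Longrightarrow> s'' b = s' b"
      have e: "env s''" using assms(1) by (subst env_cong[of s'' s]) (auto simp: env_arrs_def fr fr')
      have "eval row_wt s'' wt 0 = ?f r i"
        using assms(2) i r by (subst row_wt[OF e]) (auto simp: fr fr')
      then show "aval (Plus (Load rowS (X vr)) (X vv)) (eval row_wt s'') = r * Suc m + i \<and>
        aval (X wt) (eval row_wt s'') = ?f r i"
        using i r e env_simps(8)[OF e] by (auto simp: fr fr' eval_frame)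
    qed (use assms r fr in auto)
  qed (use assms in auto)
  then show ?thesis using assms by (simp add: tbl_def)
qed

definition "vtb A r b = (A (r * Suc K + b) :: nat)"

lemma vtb_upd:
  "b \<le> K \<Longrightarrow> b' \<le> K \<Longrightarrow>
    vtb (A(r * Suc K + b := x)) r' b' = (if r' = r \<and> b' = b then x else vtb A r' b')"
  unfolding vtb_def using row_major_inj[of b "Suc K" b' r r'] by auto

lemma tbl_upd:
  "i \<le> m \<Longrightarrow> i' \<le> m \<Longrightarrow>
    tbl (A(r * Suc m + i := x)) r' i' = (if r' = r \<and> i' = i then x else tbl A r' i')"
  unfolding tbl_def using row_major_inj[of i "Suc m" i' r r'] by auto

lemma a0_le: "v \<le> m \<Longrightarrow> a 0 \<le> a v"
  using mono by (auto simp: mono_on_def)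

text \<open>The Bellman equation of row \<open>r\<close> at budget \<open>b\<close>:
  \<open>l\<close> is the optimum and \<open>v\<close> attains it. \<open>b + a 0 - a v\<close> is
  the budget left after paying \<open>a v - a 0\<close>; adding first keeps truncated subtraction
  exact.\<close>

definition dp_good where
  "dp_good C V r b l v \<longleftrightarrow> v < m \<and> a v \<le> b + a 0 \<and> l = V r (b + a 0 - a v) + C r v \<and>
     (\<forall>v'<m. a v' \<le> b + a 0 \<longrightarrow> l \<le> V r (b + a 0 - a v') + (C r v' :: nat))"

text \<open>By monotonicity \<open>a 0 \<le> a v\<close>, so the recursion looks only at budgets up
  to \<open>b\<close>, hence within the table.\<close>

lemma dp_good_cong:
  assumes "\<And>b. b \<le> K \<Longrightarrow> V' r b = V r b" "b \<le> K"
  shows "dp_good C V' r b l v \<longleftrightarrow> dp_good C V r b l v"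
proof -
  have "V' r (b + a 0 - a v) = V r (b + a 0 - a v)" if "v < m" for v
    using a0_le[of v] that assms(2) by (intro assms(1)) linarith
  then show ?thesis unfolding dp_good_def by auto
qed

lemma dp_entry:
  assumes "env s" "s vr 0 < k" "s vb 0 \<le> K"
  shows "dp_good (tbl (s arrC)) (vtb (s arrV)) (s vr 0) (s vb 0) (eval dp_entry s low 0) (eval dp_entry s arg 0)"
proof -
  let ?r = "s vr 0" and ?b = "s vb 0"
  let ?val = "\<lambda>v. vtb (s arrV) ?r (?b + a 0 - a v) + tbl (s arrC) ?r v"
  let ?I = "\<lambda>n s'. s' arg 0 < m \<and> a (s' arg 0) \<le> ?b + a 0 \<and> s' low 0 = ?val (s' arg 0) \<and>
     (\<forall>v'<n. a v' \<le> ?b + a 0 \<longrightarrow> s' low 0 \<le> ?val v')"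
  have "?I m (eval dp_entry s)"
    unfolding dp_entry_def eval.simps(3)
  proof (rule FOR_rule[where I = ?I], goal_cases)
    case (7 v s')
    have fr: "s' b = s b" if "b \<notin> {low, arg, vv}" for b
      using 7(4)[of b] that by auto
    have av: "aval av s' = a v" "aval a0 s' = a 0" "aval (X vb) s' = ?b" "aval (X low) s' = s' low 0"
        "aval (X vv) s' = v"
      using assms 7(1,3) by (auto simp: fr)
    have dv: "aval dp_val s' = ?val v"
      using assms 7(1,3) by (auto simp: fr tbl_def vtb_def)
    have c: "bval (BAnd (BNot (BLess (Plus (X vb) a0) av)) (BLess dp_val (X low))) s' \<longleftrightarrow>
        a v \<le> ?b + a 0 \<and> ?val v < s' low 0"
      by (simp only: bval.simps aval.simps(3)[of "X vb" a0] dv av not_less)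
    show ?case
    proof (cases "a v \<le> ?b + a 0 \<and> ?val v < s' low 0")
      case True
      then have "eval (IF (BAnd (BNot (BLess (Plus (X vb) a0) av)) (BLess dp_val (X low)))
        (SET low dp_val ;; SET arg (X vv)) NOP) s' = upd (upd s' low 0 (?val v)) arg 0 v"
        by (simp only: eval.simps c dv if_True simp_thms) (use 7(3) in simp)
      then show ?thesis using 7(1,2) True by (auto simp: less_Suc_eq dest: order.trans)
    next
      case False
      then have "eval (IF (BAnd (BNot (BLess (Plus (X vb) a0) av)) (BLess dp_val (X low)))
        (SET low dp_val ;; SET arg (X vv)) NOP) s' = s'"
        by (simp only: eval.simps c if_False)
      then show ?thesis using 7(1,2) False by (auto simp: less_Suc_eq)
    qed
  qed (use assms m_pos in \<open>auto simp: tbl_def vtb_def\<close>)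
  then show ?thesis unfolding dp_good_def by blast
qed

lemma dp_row:
  assumes "env s" "s vr 0 < k"
  shows "(\<forall>r\<le>s vr 0. \<forall>b\<le>K. vtb (eval dp_row s arrV) r b = vtb (s arrV) r b) \<and>
    (\<forall>r<s vr 0. \<forall>b\<le>K. vtb (eval dp_row s arrArg) r b = vtb (s arrArg) r b) \<and>
    (\<forall>b<Suc K. dp_good (tbl (s arrC)) (vtb (s arrV)) (s vr 0) b
       (vtb (eval dp_row s arrV) (Suc (s vr 0)) b) (vtb (eval dp_row s arrArg) (s vr 0) b))"
  unfolding dp_row_def
proof (rule FOR_rule[where I = "\<lambda>n s'. (\<forall>r\<le>s vr 0. \<forall>b\<le>K. vtb (s' arrV) r b = vtb (s arrV) r b) \<and>
    (\<forall>r<s vr 0. \<forall>b\<le>K. vtb (s' arrArg) r b = vtb (s arrArg) r b) \<and>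
    (\<forall>b<n. dp_good (tbl (s arrC)) (vtb (s arrV)) (s vr 0) b
       (vtb (s' arrV) (Suc (s vr 0)) b) (vtb (s' arrArg) (s vr 0) b))"], goal_cases)
  case (7 b s')
  have fr: "s' b = s b" if "b \<notin> {low, arg, vv, vb, arrArg, arrV}" for b
    using 7(4)[of b] that by auto
  have e: "env s'" using assms(1) by (subst env_cong[of s' s]) (auto simp: env_arrs_def fr)
  let ?s = "eval dp_entry s'"
  have "dp_good (tbl (s' arrC)) (vtb (s' arrV)) (s' vr 0) b (?s low 0) (?s arg 0)"
    using dp_entry[OF e] 7(1,3) assms by (auto simp: fr)
  then have g: "dp_good (tbl (s arrC)) (vtb (s arrV)) (s vr 0) b (?s low 0) (?s arg 0)"
    using 7(1,2) by (subst (asm) dp_good_cong[where V = "vtb (s arrV)"]) (auto simp: fr)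
  have V: "eval (dp_entry ;; ASSIGN arrArg (Plus (Load rowV (X vr)) (X vb)) (X arg) ;;
      ASSIGN arrV (Plus (Load rowV (Plus (X vr) (Const 1))) (X vb)) (X low)) s' arrV =
      (s' arrV)(Suc (s vr 0) * Suc K + b := ?s low 0)"
    and A: "eval (dp_entry ;; ASSIGN arrArg (Plus (Load rowV (X vr)) (X vb)) (X arg) ;;
      ASSIGN arrV (Plus (Load rowV (Plus (X vr) (Const 1))) (X vb)) (X low)) s' arrArg =
      (s' arrArg)(s vr 0 * Suc K + b := ?s arg 0)"
    using e assms by (auto simp: eval_frame fr 7(3) fun_eq_iff)
  show ?case
    unfolding V A using 7(1,2) g by (auto simp: vtb_upd less_Suc_eq simp del: mult_Suc mult_Suc_right)
qed (use assms in auto)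

lemma dp_all:
  assumes "env s"
  shows "(\<forall>b\<le>K. vtb (eval dp_all s arrV) 0 b = 0) \<and>
    (\<forall>r<k. \<forall>b\<le>K. dp_good (tbl (s arrC)) (vtb (eval dp_all s arrV)) r b
       (vtb (eval dp_all s arrV) (Suc r) b) (vtb (eval dp_all s arrArg) r b))"
  unfolding dp_all_def eval.simps(3)
proof (rule FOR_rule[where I = "\<lambda>n s'. (\<forall>b\<le>K. vtb (s' arrV) 0 b = 0) \<and>
    (\<forall>r<n. \<forall>b\<le>K. dp_good (tbl (s arrC)) (vtb (s' arrV)) r b
       (vtb (s' arrV) (Suc r) b) (vtb (s' arrArg) r b))"], goal_cases)
  case 5
  have "eval dp_init s arrV = (\<lambda>x. if 0 \<le> x \<and> x < 0 + Suc K then 0 else s arrV x)"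
    unfolding dp_init_def by (rule FOR_fill) (use assms in auto)
  then show ?case by (simp add: vtb_def)
next
  case (7 r s')
  have fr: "s' b = s b" if "b \<notin> {low, arg, vv, vb, arrArg, arrV, vr}" for b
    using 7(4)[of b] that by (auto simp: eval_frame)
  have e: "env s'" using assms(1) by (subst env_cong[of s' s]) (auto simp: env_arrs_def fr)
  from dp_row[OF e] 7(1,3) have row: "(\<forall>r'\<le>r. \<forall>b\<le>K. vtb (eval dp_row s' arrV) r' b = vtb (s' arrV) r' b)"
    "(\<forall>r'<r. \<forall>b\<le>K. vtb (eval dp_row s' arrArg) r' b = vtb (s' arrArg) r' b)"
    "(\<forall>b\<le>K. dp_good (tbl (s' arrC)) (vtb (s' arrV)) r b
       (vtb (eval dp_row s' arrV) (Suc r) b) (vtb (eval dp_row s' arrArg) r b))"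
    by (auto simp: less_Suc_eq_le)
  have cong: "dp_good C (vtb (eval dp_row s' arrV)) r' b l v \<longleftrightarrow> dp_good C (vtb (s' arrV)) r' b l v"
    if "r' \<le> r" "b \<le> K" for C r' b l v
    using row(1) that by (intro dp_good_cong) auto
  show ?case using 7(2) row by (auto simp: less_Suc_eq cong fr)
qed (use assms in \<open>auto simp: eval_frame\<close>)

definition "dp_ok C V G \<longleftrightarrow> (\<forall>b\<le>K. V 0 b = 0) \<and>
    (\<forall>r<k. \<forall>b\<le>K. dp_good C V r b (V (Suc r) b) (G r b))"

text \<open>Induction on the rows with the minimality clause of \<open>dp_good\<close>: paying for
  the last row leaves a budget that covers the others. That the bound is attained is shown by the
  traceback.\<close>

lemma dp_lower:
  assumes "dp_ok C V G" "n \<le> k" "b \<le> K" "\<forall>r<n. vs r < m" "(\<Sum>r<n. a (vs r) - a 0) \<le> b"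
  shows "V n b \<le> (\<Sum>r<n. C r (vs r))"
  using assms(2-)
proof (induction n arbitrary: b)
  case 0
  then show ?case using assms(1) by (simp add: dp_ok_def)
next
  case (Suc n)
  let ?v = "vs n"
  have v: "?v < m" "a 0 \<le> a ?v" using Suc.prems a0_le by auto
  have "dp_good C V n b (V (Suc n) b) (G n b)"
    using assms(1) Suc.prems by (simp add: dp_ok_def)
  moreover have "a ?v \<le> b + a 0" using Suc.prems(4) by simp
  ultimately have "V (Suc n) b \<le> V n (b + a 0 - a ?v) + C n ?v"
    using v(1) unfolding dp_good_def by blast
  also have "V n (b + a 0 - a ?v) \<le> (\<Sum>r<n. C r (vs r))"
    using Suc.prems v by (intro Suc.IH) auto
  finally show ?case by simp
qed

lemma walk:
  assumes "env s" "s bud 0 \<le> K" and ok: "dp_ok C (vtb (s arrV)) (vtb (s arrArg))"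
  shows "(\<forall>r<k. eval walk s arrCol r < m) \<and>
     (\<Sum>r<k. C r (eval walk s arrCol r)) = vtb (s arrV) k (s bud 0) \<and>
     (\<Sum>r<k. a (eval walk s arrCol r) - a 0) \<le> s bud 0"
proof -
  let ?V = "vtb (s arrV)"
  \<comment> \<open>After \<open>n\<close> passes the rows from \<open>k - n\<close> on are chosen.
    Table value of the rest plus cost so far, and budget left plus budget spent, are both
    constant.\<close>
  let ?I = "\<lambda>n s'. s' bud 0 \<le> K \<and> (\<forall>r\<in>{k-n..<k}. s' arrCol r < m) \<and>
     ?V (k - n) (s' bud 0) + (\<Sum>r\<in>{k-n..<k}. C r (s' arrCol r)) = ?V k (s bud 0) \<and>
     (\<Sum>r\<in>{k-n..<k}. a (s' arrCol r) - a 0) + s' bud 0 = s bud 0"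
  have "?I k (eval walk s)"
    unfolding walk_def
  proof (rule FOR_rule[where I = ?I], goal_cases)
    case (7 n s')
    have fr: "s' b = s b" if "b \<notin> {vr, acc, arg, arrCol, bud}" for b
      using 7(4)[of b] that by auto
    have e: "env s'" using assms(1) by (subst env_cong[of s' s]) (auto simp: env_arrs_def fr)
    define rr where "rr = k - Suc n"
    define b where "b = s' bud 0"
    define v where "v = vtb (s arrArg) rr b"
    have rr: "k - n = Suc rr" "rr < k" "k - Suc n = rr" using 7(1) by (auto simp: rr_def)
    have bK: "b \<le> K" using 7(2) by (simp add: b_def)
    have "dp_good C ?V rr b (?V (Suc rr) b) v"
      using ok rr bK by (auto simp: dp_ok_def v_def)
    then have v: "v < m" "a v \<le> b + a 0" "?V (Suc rr) b = ?V rr (b + a 0 - a v) + C rr v"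
      by (auto simp: dp_good_def)
    let ?c = "SET acc (Minus (param 2) (Plus (X vr) (Const 1))) ;;
      SET arg (Load arrArg (Plus (Load rowV (X acc)) (X bud))) ;;
      ASSIGN arrCol (X acc) (X arg) ;;
      SET bud (Minus (Plus (X bud) a0) (Load (Input 1) (X arg)))"
    have ev: "eval ?c s' arrCol = (s' arrCol)(rr := v)" "eval ?c s' bud 0 = b + a 0 - a v"
    proof -
      have h: "s' par 2 - Suc (s' vr 0) = rr" "s' rowV rr = rr * Suc K" "s' arrArg (rr * Suc K + b) = v"
        "s' (Input (Suc 0)) v = a v" "s' (Input (Suc 0)) 0 = a 0" "s' bud 0 = b"
        using e v(1) rr 7(3) by (simp_all add: b_def v_def vtb_def fr[of arrArg])
      show "eval ?c s' arrCol = (s' arrCol)(rr := v)" "eval ?c s' bud 0 = b + a 0 - a v"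
        by (simp_all add: h fun_eq_iff del: mult_Suc_right)
    qed
    have sp: "{rr..<k} = insert rr {Suc rr..<k}" using rr by auto
    have I: "\<forall>r\<in>{Suc rr..<k}. s' arrCol r < m"
      "?V (Suc rr) b + (\<Sum>r\<in>{Suc rr..<k}. C r (s' arrCol r)) = ?V k (s bud 0)"
      "(\<Sum>r\<in>{Suc rr..<k}. a (s' arrCol r) - a 0) + b = s bud 0"
      using 7(2) by (simp_all add: rr b_def)
    have s1: "(\<Sum>r\<in>{Suc rr..<k}. C r (((s' arrCol)(rr := v)) r)) = (\<Sum>r\<in>{Suc rr..<k}. C r (s' arrCol r))"
      "(\<Sum>r\<in>{Suc rr..<k}. a (((s' arrCol)(rr := v)) r) - a 0) = (\<Sum>r\<in>{Suc rr..<k}. a (s' arrCol r) - a 0)"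
      by (auto intro!: sum.cong)
    show ?case
      unfolding rr ev sp using I v bK a0_le[of v] by (auto simp: s1 simp del: fun_upd_apply) (auto)
  qed (use assms in auto)
  then show ?thesis using ok by (auto simp: dp_ok_def atLeast0LessThan)
qed

text \<open>
  The bound on the final scores is \<open>T = sm + k * a 0 + \<tau>\<close>; charging \<open>a v - a 0\<close> instead of \<open>a v\<close> makes the
  column of zeros feasible for every \<open>\<tau>\<close>.
\<close>

definition "cap \<tau> i = min K (\<tau> + sm - \<sigma> (Suc i))"

definition feas :: "nat \<Rightarrow> nat \<Rightarrow> (nat \<Rightarrow> nat) \<Rightarrow> bool" where
  "feas \<tau> i vs \<longleftrightarrow> (\<forall>r<k. vs r < m) \<and> (\<Sum>r<k. a (vs r) - a 0) \<le> cap \<tau> i"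

definition setcol :: "(nat \<Rightarrow> nat \<Rightarrow> nat) \<Rightarrow> nat \<Rightarrow> (nat \<Rightarrow> nat) \<Rightarrow> nat \<Rightarrow> nat \<Rightarrow> nat" where
  "setcol S i vs = (\<lambda>r. (S r)(Suc i := vs r))"

definition Phi :: "nat \<Rightarrow> (nat \<Rightarrow> nat \<Rightarrow> nat) \<Rightarrow> nat" where
  "Phi q S = (\<Sum>r<k. rowpot q (S r))"

definition best_step :: "nat \<Rightarrow> nat \<Rightarrow> (nat \<Rightarrow> nat \<Rightarrow> nat) \<Rightarrow> nat \<Rightarrow> (nat \<Rightarrow> nat) \<Rightarrow> nat \<Rightarrow> bool" where
  "best_step \<tau> q S i vs n \<longleftrightarrow> i < n \<and> feas \<tau> i vs \<and>
     (\<forall>i'<n. \<forall>vs'. feas \<tau> i' vs' \<longrightarrow> Phi q (setcol S i vs) \<le> Phi q (setcol S i' vs'))"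

lemma set_bud:
  assumes "env s" "s vi 0 < m"
  shows "eval set_bud s bud 0 = cap (s vtau 0) (s vi 0)"
  using assms by (auto simp: set_bud_def cap_def min_def)

lemma try_col:
  assumes "env s" "\<forall>x<2*m. s arrF x = weight q x" "s vi 0 < m"
    and prev: "s vi 0 = 0 \<or> best_step (s vtau 0) q (tbl (s arrS)) (s besti 0) (s arrCol) (s vi 0) \<and>
      s bestval 0 = Phi q (setcol (tbl (s arrS)) (s besti 0) (s arrCol))"
  defines "s' \<equiv> eval try_col s"
  shows "best_step (s vtau 0) q (tbl (s arrS)) (s' besti 0) (s' arrCol) (Suc (s vi 0)) \<and>
      s' bestval 0 = Phi q (setcol (tbl (s arrS)) (s' besti 0) (s' arrCol))"
proof -
  let ?\<tau> = "s vtau 0" and ?i = "s vi 0" and ?S = "tbl (s arrS)"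
  define s1 where "s1 = eval cost_all s"
  define s2 where "s2 = eval dp_all s1"
  define s3 where "s3 = eval set_bud s2"
  define C where "C = tbl (s1 arrC)"
  have e: "env s1" "env s2" "env s3"
    using assms(1) by (simp_all add: s1_def s2_def s3_def env_arrs_def)
  have C: "(\<Sum>r<k. C r (vs r)) = Phi q (setcol ?S ?i vs)" if "\<forall>r<k. vs r < m" for vs
    unfolding Phi_def setcol_def C_def s1_def
    using that by (intro sum.cong) (auto simp: cost_all[OF assms(1,2)])
  have fr: "s3 b = s b" if "b \<notin> writes cost_all \<union> writes dp_all \<union> {bud}" for b
    using that by (simp add: s1_def s2_def s3_def eval_frame)
  have ok: "dp_ok C (vtb (s3 arrV)) (vtb (s3 arrArg))"
    using dp_all[OF e(1)] by (simp add: dp_ok_def C_def s2_def s3_def eval_frame)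
  have bud: "s3 bud 0 = cap ?\<tau> ?i"
    unfolding s3_def using e assms(3) by (subst set_bud) (auto simp: s1_def s2_def eval_frame)
  define w where "w = vtb (s3 arrV) k (s3 bud 0)"
  have capK: "cap ?\<tau> ?i \<le> K" by (simp add: cap_def)
  have lower: "w \<le> Phi q (setcol ?S ?i vs)" if "feas ?\<tau> ?i vs" for vs
    using dp_lower[OF ok order.refl capK, of vs] that C[of vs] by (auto simp: feas_def w_def bud)
  have val: "aval opt_val s3 = w" using e by (simp add: w_def vtb_def)
  have s': "s' = (if \<not> ?i < 1 \<and> \<not> w < s bestval 0 then s3
      else eval walk (upd (upd s3 bestval 0 w) besti 0 ?i))"
    using val fr[of vi] fr[of bestval] by (simp add: s'_def try_col_def s1_def s2_def s3_def)
  show ?thesis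
  proof (cases "\<not> ?i < 1 \<and> \<not> w < s bestval 0")
    case True
    then have "s' = s3" by (simp add: s')
    then have "s' besti = s besti" "s' arrCol = s arrCol" "s' bestval = s bestval" by (auto simp: fr)
    moreover have bs: "best_step ?\<tau> q ?S (s besti 0) (s arrCol) ?i"
        "s bestval 0 = Phi q (setcol ?S (s besti 0) (s arrCol))" "s bestval 0 \<le> w"
      using prev True by auto
    moreover have "s bestval 0 \<le> Phi q (setcol ?S ?i vs)" if "feas ?\<tau> ?i vs" for vs
      using lower[OF that] bs(3) by simp
    ultimately show ?thesis
      by (simp add: best_step_def less_Suc_eq)
  next
    case False
    define s4 where "s4 = upd (upd s3 bestval 0 w) besti 0 ?i"
    have s'4: "s' = eval walk s4"
      unfolding s' s4_def by (rule if_not_P[OF False])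
    have "env s4" using e by (simp add: s4_def env_arrs_def)
    moreover have "s4 bud 0 \<le> K" "dp_ok C (vtb (s4 arrV)) (vtb (s4 arrArg))"
      using ok capK by (simp_all add: s4_def bud)
    ultimately have W: "\<forall>r<k. s' arrCol r < m" "(\<Sum>r<k. C r (s' arrCol r)) = w"
      "(\<Sum>r<k. a (s' arrCol r) - a 0) \<le> cap ?\<tau> ?i"
      using walk[of s4 C] by (auto simp: s'4) (auto simp: s4_def w_def bud)
    have o: "s' besti 0 = ?i" "s' bestval 0 = w" by (simp_all add: s'4 eval_frame s4_def)
    have w: "w = Phi q (setcol ?S ?i (s' arrCol))" using W C by simp
    have "w \<le> Phi q (setcol ?S i' vs')" if "i' < Suc ?i" "feas ?\<tau> i' vs'" for i' vs'
    proof (cases "i' = ?i")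
      case ne: False
      then have "w \<le> s bestval 0" "s bestval 0 \<le> Phi q (setcol ?S i' vs')"
        using prev that False by (auto simp: best_step_def)
      then show ?thesis by simp
    qed (use lower that in auto)
    then show ?thesis
      using W o w by (auto simp: best_step_def feas_def)
  qed
qed

lemma improve:
  assumes "env s" "\<forall>x<2*m. s arrF x = weight q x"
  shows "\<exists>i vs. best_step (s vtau 0) q (tbl (s arrS)) i vs m \<and>
    (\<forall>r<k. \<forall>i'\<le>m. tbl (eval improve s arrS) r i' = setcol (tbl (s arrS)) i vs r i')"
proof -
  let ?I = "\<lambda>n s'. n = 0 \<or> best_step (s vtau 0) q (tbl (s arrS)) (s' besti 0) (s' arrCol) n \<and>
      s' bestval 0 = Phi q (setcol (tbl (s arrS)) (s' besti 0) (s' arrCol))"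
  define s1 where "s1 = eval (FOR vi 0 try_col) s"
  have "?I m s1"
    unfolding s1_def
  proof (rule FOR_rule[where I = ?I], goal_cases)
    case (7 i s')
    have fr: "s' b = s b" if "b \<notin> insert vi (writes try_col)" for b
      using 7(4)[of b] that by auto
    have e: "env s'" using assms(1) by (subst env_cong[of s' s]) (auto simp: env_arrs_def fr)
    have F: "\<forall>x<2*m. s' arrF x = weight q x" using assms(2) by (simp add: fr)
    show ?case using try_col[OF e F] 7(1,2,3) by (simp add: fr)
  qed (use assms in auto)
  then have bs: "best_step (s vtau 0) q (tbl (s arrS)) (s1 besti 0) (s1 arrCol) m" (is "best_step _ _ _ ?i ?vs _")
    using m_pos by auto
  then have i: "?i < m" by (simp add: best_step_def)
  have e: "env s1" using assms by (simp add: s1_def env_arrs_def)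
  have S1: "s1 arrS = s arrS" by (simp add: s1_def eval_frame)
  have "\<forall>r i'. i' \<le> m \<longrightarrow> tbl (eval put_col s1 arrS) r i' =
      (if r < k \<and> i' = Suc ?i then ?vs r else tbl (s1 arrS) r i')"
    unfolding put_col_def
  proof (rule FOR_rule[where I = "\<lambda>n s'. \<forall>r i'. i' \<le> m \<longrightarrow> tbl (s' arrS) r i' =
      (if r < n \<and> i' = Suc ?i then ?vs r else tbl (s1 arrS) r i')"], goal_cases)
    case (7 n s')
    have fr: "s' b = s1 b" if "b \<notin> {vr, arrS}" for b
      using 7(4)[of b] that by auto
    have ev: "eval (ASSIGN arrS (Plus (Load rowS (X vr)) (Plus (X besti) (Const 1))) (Load arrCol (X vr))) s' arrS =
       (s' arrS)(n * Suc m + Suc ?i := ?vs n)"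
      using e 7(1,3) by (simp add: fr)
    show ?case
      unfolding ev using 7(2) i by (auto simp: tbl_upd less_Suc_eq simp del: mult_Suc_right add_Suc_right)
  qed (use e in auto)
  then have "\<forall>r<k. \<forall>i'\<le>m. tbl (eval improve s arrS) r i' = setcol (tbl (s arrS)) ?i ?vs r i'"
    by (simp add: improve_def s1_def[symmetric] setcol_def S1)
  with bs show ?thesis by blast
qed

end

section \<open>Balance of local optima\<close>

lemma ln_one_plus_inverse_bounds:
  fixes q :: real
  assumes "q \<ge> 1"
  shows "1 / (2 * q) \<le> ln (1 + 1 / q)" "ln (1 + 1 / q) \<le> 1 / q"
proof -
  have "ln (q / (q + 1)) \<le> q / (q + 1) - 1"
    using assms by (intro ln_le_minus_one) auto
  also have "\<dots> = - (1 / (q + 1))" using assms by (simp add: field_simps)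
  finally have "1 / (q + 1) \<le> - ln (q / (q + 1))" by simp
  also have "- ln (q / (q + 1)) = ln (1 + 1 / q)"
    using assms by (subst ln_inverse[symmetric]) (auto simp: field_simps)
  finally have "1 / (q + 1) \<le> ln (1 + 1 / q)" .
  moreover have "1 / (2 * q) \<le> 1 / (q + 1)" using assms by (intro divide_left_mono) auto
  ultimately show "1 / (2 * q) \<le> ln (1 + 1 / q)" by simp
  show "ln (1 + 1 / q) \<le> 1 / q"
    using assms by (intro ln_add_one_self_le_self) auto
qed

text \<open>Trades the weighted imbalance for the weight alone, at rate \<open>c\<close>. Where
  \<open>c \<le> x\<close> this is plain; below \<open>c\<close> the difference of exponentials is
  not positive, and for negative \<open>x\<close> the product is at least \<open>- 1 / l\<close>,
  hence at least \<open>- 2 * q\<close>.\<close>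

lemma exp_times_self_lower:
  fixes l c q x :: real
  assumes "1 / (2 * q) \<le> l" "0 < q" "0 \<le> c"
  shows "c * (exp (l * x) - exp (l * c)) - 2 * q \<le> exp (l * x) * x"
proof -
  have l: "l > 0" using assms by (smt (verit) divide_pos_pos)
  consider "c \<le> x" | "0 \<le> x" "x < c" | "x < 0" by linarith
  then show ?thesis
  proof cases
    case 1
    then have "c * exp (l * x) \<le> exp (l * x) * x" by (simp add: mult.commute)
    moreover have "0 \<le> c * exp (l * c)" using assms by simp
    ultimately show ?thesis unfolding right_diff_distrib using assms by linarith
  next
    case 2
    then have "exp (l * x) \<le> exp (l * c)" using l by simp
    then have "c * (exp (l * x) - exp (l * c)) \<le> 0" using assms by (simp add: mult_nonneg_nonpos)
    moreover have "0 \<le> exp (l * x) * x" using 2 by simp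
    ultimately show ?thesis using assms by linarith
  next
    case 3
    have "l * (- x) \<le> exp (l * (- x))" by (rule order.trans[OF _ exp_ge_add_one_self]) simp
    then have "exp (l * x) * (l * (- x)) \<le> exp (l * x) * exp (l * (- x))"
      by (intro mult_left_mono) auto
    also have "\<dots> = 1" by (simp flip: exp_add)
    finally have "l * (exp (l * x) * (- x)) \<le> 1" by (simp add: mult_ac)
    then have "exp (l * x) * (- x) \<le> 1 / l" using l by (simp add: field_simps)
    also have "\<dots> \<le> 2 * q" using assms l by (simp add: field_simps)
    finally have "- 2 * q \<le> exp (l * x) * x" by simp
    moreover have "exp (l * x) \<le> exp (l * c)" using l 3 assms by simp
    then have "c * (exp (l * x) - exp (l * c)) \<le> 0" using assms by (simp add: mult_nonneg_nonpos)
    ultimately show ?thesis by linarith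
  qed
qed

text \<open>
  \<open>A\<close> and \<open>B\<close> are the averaged first-order conditions for the moves to an optimal strategy and for the
  exchanges within a column.  The bound does not depend on \<open>k\<close>.
\<close>

lemma balanced_loads:
  fixes e :: "nat \<Rightarrow> nat \<Rightarrow> real" and q :: real and m k :: nat
  assumes q: "q \<ge> 1" "q ^ 2 \<le> m" and k: "k \<ge> 1"
  defines "w \<equiv> \<lambda>x. exp (ln (1 + 1 / q) * x)"
  defines "W \<equiv> \<lambda>r. \<Sum>j<m. w (e r j)"
  defines "\<Phi> \<equiv> \<Sum>r<k. W r"
  assumes A: "- m * (\<Phi> / (k * q ^ 2)) \<le>
      (\<Sum>r<k. \<Sum>j<m. w (e r j) * ((0 - e r j) / q + m / q ^ 2))"
    and B: "\<And>r r'. r < k \<Longrightarrow> r' < k \<Longrightarrow> - m * (\<Phi> / (k * q ^ 2)) \<le>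
      (\<Sum>j<m. w (e r j) * ((e r' j - e r j) / q + m / q ^ 2)) +
      (\<Sum>j<m. w (e r' j) * ((e r j - e r' j) / q + m / q ^ 2))"
    and rj: "r < k" "j < m"
  shows "w (e r j) \<le> 20 * m ^ 2 * exp (27 * m / q ^ 2)"
proof -
  define l where "l = ln (1 + 1 / q)"
  have l: "1 / (2 * q) \<le> l" "l \<le> 1 / q"
    using ln_one_plus_inverse_bounds[OF q(1)] by (auto simp: l_def)
  have l0: "l > 0" using l(1) q(1) by (smt (verit) divide_pos_pos)
  have w: "w x = exp (l * x)" for x by (simp add: w_def l_def)
  have w0: "w x > 0" for x by (simp add: w)
  have w_mono: "x \<le> y \<Longrightarrow> w x \<le> w y" for x y using l0 by (simp add: w)
  have m: "real m \<ge> 1" using q by (smt (verit) one_le_power)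
  \<comment> \<open>\<open>z\<close> is the imbalance whose first-order effect \<open>z / q\<close>
    equals \<open>m / q ^ 2\<close>, the second-order error of \<open>m\<close> moves.\<close>
  define z where "z = m / q"
  have z: "z > 0" using m q by (simp add: z_def)
  have zq: "z / q = m / q ^ 2" by (simp add: z_def power2_eq_square)
  have W0: "W r \<ge> 0" for r unfolding W_def by (intro sum_nonneg) (simp add: w0 less_imp_le)
  have \<Phi>0: "\<Phi> \<ge> 0" unfolding \<Phi>_def by (intro sum_nonneg W0)
  have eps: "m * (\<Phi> / (k * q ^ 2)) = z * \<Phi> / (k * q)"
    by (simp add: z_def power2_eq_square)

  \<comment> \<open>The level \<open>3 * z\<close> exceeds the factor \<open>2 * z\<close> in the
    bound \<open>SA\<close> below by \<open>z\<close>; this surplus yields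
    \<open>\<Phi> \<le> k * M\<close>.\<close>
  define w3 where "w3 = w (3 * z)"
  have w3: "w3 \<ge> 1" using z l0 by (simp add: w3_def w)
  define M where "M = 5 * m * w3"
  have M: "M > 0" using m w3 by (simp add: M_def)
  have "(\<Sum>r<k. \<Sum>j<m. w (e r j) * ((0 - e r j) / q + m / q ^ 2)) =
      (\<Sum>r<k. \<Sum>j<m. (z / q) * w (e r j) - (w (e r j) * e r j) / q)"
    by (simp add: zq[symmetric] algebra_simps)
  also have "\<dots> = (z / q) * \<Phi> - (\<Sum>r<k. \<Sum>j<m. w (e r j) * e r j) / q"
    by (simp add: \<Phi>_def W_def sum_subtractf sum_distrib_left sum_divide_distrib)
  finally have "(\<Sum>r<k. \<Sum>j<m. w (e r j) * e r j) / q \<le> (z / q) * \<Phi> + z * \<Phi> / (k * q)"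
    using A eps by simp
  also have "\<dots> \<le> (z / q) * \<Phi> + (z / q) * \<Phi>"
  proof -
    have "z * \<Phi> / (k * q) \<le> z * \<Phi> / (1 * q)"
      using z \<Phi>0 k q by (intro divide_left_mono mult_right_mono) auto
    then show ?thesis by (simp only: times_divide_eq_left mult_1 add_le_cancel_left)
  qed
  finally have SA: "(\<Sum>r<k. \<Sum>j<m. w (e r j) * e r j) \<le> 2 * z * \<Phi>"
    using q by (simp add: field_simps)
  have "(\<Sum>r<k. \<Sum>j<m. 3 * z * (w (e r j) - w3) - 2 * q) \<le> (\<Sum>r<k. \<Sum>j<m. w (e r j) * e r j)"
    using exp_times_self_lower[OF l(1), of "3 * z"] z q
    by (intro sum_mono) (simp add: w w3_def)
  also have "(\<Sum>r<k. \<Sum>j<m. 3 * z * (w (e r j) - w3) - 2 * q) =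
      3 * z * \<Phi> - k * m * (3 * z * w3 + 2 * q)"
    by (simp add: \<Phi>_def W_def sum_subtractf sum_distrib_left algebra_simps)
  finally have "z * \<Phi> \<le> k * m * (3 * z * w3 + 2 * q)"
    using SA by linarith
  also have "\<dots> \<le> k * m * (3 * z * w3 + 2 * z * w3)"
  proof -
    have "q \<le> z" using q by (simp add: z_def field_simps power2_eq_square)
    also have "z \<le> z * w3" using z w3 by simp
    finally show ?thesis by (intro mult_left_mono) (auto simp: mult.commute)
  qed
  also have "\<dots> = z * (k * M)" by (simp add: M_def algebra_simps)
  finally have \<Phi>M: "\<Phi> \<le> k * M" using z by simp

  have fin: "finite (W ` {..<k})" "W ` {..<k} \<noteq> {}" using k by (auto simp: lessThan_empty_iff)
  from Max_in[OF fin] obtain p where p: "p < k" "W p = Max (W ` {..<k})" by auto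
  have pmax: "W r \<le> W p" if "r < k" for r using that fin by (simp add: p(2))
  have \<Phi>p: "\<Phi> \<le> k * W p"
    unfolding \<Phi>_def using sum_bounded_above[of "{..<k}" W "W p"] pmax by simp
  \<comment> \<open>\<open>D / 4 = 6 * z\<close> is twice the coefficient \<open>3 * z\<close> that
    it meets at the end. \<open>E\<close> is the level of weight \<open>2 * M\<close>, twice the
    bound on the mean row potential.\<close>
  define D where "D = 24 * z"
  define E where "E = ln (2 * M) / l"
  have wE: "w E = 2 * M" using M l0 by (simp add: w E_def)
  have "l * D \<ge> 1"
  proof -
    have "1 \<le> 24 * (1 / (2 * q)) * z"
      using q m by (simp add: z_def field_simps power2_eq_square)
    also have "\<dots> \<le> 24 * l * z" using l z by (intro mult_right_mono mult_left_mono) auto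
    finally show ?thesis by (simp add: D_def mult_ac)
  qed
  then have "exp 1 \<le> exp (l * D)" by simp
  moreover have "exp 1 \<ge> (2::real)" using exp_ge_add_one_self[of 1] by simp
  ultimately have lD: "exp (l * D) \<ge> 2" by linarith
  have wED: "w (E + D) = 2 * M * exp (l * D)"
    by (simp add: w exp_add distrib_left flip: wE)
  have wED4: "w (E + D) \<ge> 4 * M"
    using mult_left_mono[OF lD, of "2 * M"] M by (simp add: wED)
  have D0: "D > 0" using z by (simp add: D_def)

  have pair: "(w x - w y) * (x - y) \<ge> 0" for x y
    using w_mono[of x y] w_mono[of y x] by (cases "x \<le> y") (auto intro: mult_nonneg_nonneg mult_nonpos_nonpos)
  \<comment> \<open>If row \<open>p\<close> is at least \<open>D\<close> above \<open>E\<close> at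
    threshold \<open>j\<close>, then at least half of the rows are at most \<open>E\<close> there;
    against each of them the weights differ by at least half of \<open>w (e p j)\<close> and the
    imbalances by at least \<open>D\<close>. Otherwise the left side is not positive.\<close>
  have col: "(k * D / 4) * (w (e p j) - w (E + D)) \<le> (\<Sum>r<k. (w (e p j) - w (e r j)) * (e p j - e r j))"
    if "j < m" for j
  proof (cases "e p j \<ge> E + D")
    case False
    then have "w (e p j) \<le> w (E + D)" by (intro w_mono) simp
    then have "(k * D / 4) * (w (e p j) - w (E + D)) \<le> 0"
      using D0 by (simp add: mult_nonneg_nonpos)
    also have "0 \<le> (\<Sum>r<k. (w (e p j) - w (e r j)) * (e p j - e r j))"
      by (intro sum_nonneg pair)
    finally show ?thesis .
  next
    case True
    let ?x = "e p j"
    have wx: "w ?x \<ge> 4 * M" using w_mono[OF True] wED4 by simp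
    \<comment> \<open>The factor on the left is Markov's inequality: at most half of the rows have weight above \<open>2 * M\<close>.\<close>
    have tm: "(1 - w (e r j) / (2 * M)) * (w ?x / 2 * D) \<le> (w ?x - w (e r j)) * (?x - e r j)" for r
    proof (cases "w (e r j) \<le> 2 * M")
      case le: True
      then have "w (e r j) \<le> w E" by (simp only: wE)
      then have "e r j \<le> E" using l0 by (simp add: w)
      then have "D \<le> ?x - e r j" using True by linarith
      moreover have "w ?x / 2 \<le> w ?x - w (e r j)" using wx le by linarith
      ultimately have 1: "w ?x / 2 * D \<le> (w ?x - w (e r j)) * (?x - e r j)"
        using D0 w0[of ?x] by (intro mult_mono) auto
      have "(1 - w (e r j) / (2 * M)) * (w ?x / 2 * D) \<le> 1 * (w ?x / 2 * D)"
        using M w0[of "e r j"] w0[of ?x] D0 by (intro mult_right_mono) auto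
      with 1 show ?thesis by simp
    next
      case False
      then have "1 - w (e r j) / (2 * M) \<le> 0" using M by (simp add: field_simps)
      then have "(1 - w (e r j) / (2 * M)) * (w ?x / 2 * D) \<le> 0"
        using w0[of ?x] D0 by (intro mult_nonpos_nonneg) auto
      with pair[of ?x "e r j"] show ?thesis by simp
    qed
    have "w (e r j) \<le> W r" for r
      unfolding W_def using \<open>j < m\<close> by (intro member_le_sum) (auto intro: less_imp_le w0)
    then have "(\<Sum>r<k. w (e r j)) \<le> \<Phi>" unfolding \<Phi>_def by (intro sum_mono)
    with \<Phi>M have "(\<Sum>r<k. w (e r j)) / (2 * M) \<le> k / 2" using M by (simp add: field_simps)
    then have "k / 2 \<le> k - (\<Sum>r<k. w (e r j)) / (2 * M)" by simp
    also have "\<dots> = (\<Sum>r<k. 1 - w (e r j) / (2 * M))"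
      by (simp add: sum_subtractf sum_divide_distrib)
    finally have "k / 2 * (w ?x / 2 * D) \<le> (\<Sum>r<k. 1 - w (e r j) / (2 * M)) * (w ?x / 2 * D)"
      using w0[of ?x] D0 by (intro mult_right_mono) auto
    also have "\<dots> = (\<Sum>r<k. (1 - w (e r j) / (2 * M)) * (w ?x / 2 * D))"
      by (rule sum_distrib_right)
    also have "\<dots> \<le> (\<Sum>r<k. (w ?x - w (e r j)) * (?x - e r j))"
      by (intro sum_mono tm)
    finally have "(k * D / 4) * w ?x \<le> (\<Sum>r<k. (w ?x - w (e r j)) * (?x - e r j))"
      by (simp add: mult_ac)
    moreover have "(k * D / 4) * (w ?x - w (E + D)) \<le> (k * D / 4) * w ?x"
      using D0 w0[of "E + D"] by (intro mult_left_mono) auto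
    ultimately show ?thesis by simp
  qed

  \<comment> \<open>Condition \<open>B\<close> for the exchange between rows \<open>p\<close> and
    \<open>r\<close>: its first-order terms combine to the product of the two differences.\<close>
  have Bp: "(\<Sum>j<m. (w (e p j) - w (e r j)) * (e p j - e r j)) \<le> z * (W p + W r) + z * \<Phi> / k"
    if "r < k" for r
  proof -
    have "(\<Sum>j<m. w (e p j) * ((e r j - e p j) / q + m / q ^ 2)) +
      (\<Sum>j<m. w (e r j) * ((e p j - e r j) / q + m / q ^ 2)) =
      (\<Sum>j<m. (z / q) * w (e p j) + (z / q) * w (e r j) - (w (e p j) - w (e r j)) * (e p j - e r j) / q)"
      unfolding sum.distrib[symmetric] zq[symmetric]
      by (intro sum.cong refl) (use q in \<open>simp add: field_simps\<close>)
    also have "\<dots> = (z / q) * (W p + W r) - (\<Sum>j<m. (w (e p j) - w (e r j)) * (e p j - e r j)) / q"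
      by (simp add: W_def sum_subtractf sum.distrib sum_distrib_left sum_divide_distrib distrib_left)
    finally have "(\<Sum>j<m. (w (e p j) - w (e r j)) * (e p j - e r j)) / q \<le>
        (z / q) * (W p + W r) + z * \<Phi> / (k * q)"
      using B[OF p(1) that] eps by simp
    then show ?thesis using q k by (simp add: field_simps)
  qed
  \<comment> \<open>One double sum, bounded below by \<open>col\<close> in each column and above by
    \<open>Bp\<close> in each row.\<close>
  have "(\<Sum>j<m. (k * D / 4) * (w (e p j) - w (E + D))) \<le>
      (\<Sum>j<m. \<Sum>r<k. (w (e p j) - w (e r j)) * (e p j - e r j))"
    by (intro sum_mono col) auto
  also have "\<dots> = (\<Sum>r<k. \<Sum>j<m. (w (e p j) - w (e r j)) * (e p j - e r j))"
    by (rule sum.swap)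
  also have "\<dots> \<le> (\<Sum>r<k. z * (W p + W r) + z * \<Phi> / k)"
    by (intro sum_mono Bp) auto
  also have "\<dots> = z * (k * W p) + z * \<Phi> + z * \<Phi>"
    unfolding distrib_left sum.distrib sum_distrib_left[symmetric] \<Phi>_def[symmetric] using k by simp
  also have "\<dots> \<le> z * (k * W p) + z * (k * W p) + z * (k * W p)"
    using \<Phi>p z by (intro add_mono mult_left_mono) auto
  also have "(\<Sum>j<m. (k * D / 4) * (w (e p j) - w (E + D))) = (k * D / 4) * (W p - m * w (E + D))"
    unfolding sum_distrib_left[symmetric] sum_subtractf W_def by simp
  finally have "(k * D / 4) * (W p - m * w (E + D)) \<le> 3 * z * k * W p"
    by (simp add: mult.assoc)
  then have "3 * z * k * W p \<le> 3 * z * k * (2 * m * w (E + D))"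
    by (simp add: D_def algebra_simps)
  moreover have "3 * z * k > 0" using z k by simp
  ultimately have "W p \<le> 2 * m * w (E + D)" by (simp only: mult_le_cancel_left_pos)
  also have "\<dots> = 20 * m ^ 2 * (exp (l * (3 * z)) * exp (l * (24 * z)))"
    unfolding wED unfolding M_def w3_def w D_def by (simp add: power2_eq_square)
  also have "\<dots> = 20 * m ^ 2 * exp (l * (27 * z))"
    by (simp flip: exp_add add: algebra_simps)
  also have "\<dots> \<le> 20 * m ^ 2 * exp (27 * m / q ^ 2)"
  proof -
    have "l * (27 * z) \<le> 1 / q * (27 * z)" using l z by (intro mult_right_mono) auto
    also have "\<dots> = 27 * m / q ^ 2" by (simp add: z_def power2_eq_square)
    finally show ?thesis by (intro mult_left_mono) auto
  qed
  finally have "W p \<le> 20 * m ^ 2 * exp (27 * m / q ^ 2)" .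
  moreover have "w (e r j) \<le> W r"
    unfolding W_def using rj by (intro member_le_sum) (auto intro: less_imp_le w0)
  ultimately show ?thesis using pmax[OF rj(1)] by linarith
qed

text \<open>Real exponents are allowed because imbalances can be negative.\<close>

definition wgt :: "nat \<Rightarrow> real \<Rightarrow> real" where
  "wgt q x = exp (ln (1 + 1 / real q) * x)"

lemma wgt_pos: "wgt q x > 0"
  by (simp add: wgt_def)

lemma wgt_add: "wgt q (x + y) = wgt q x * wgt q y"
  by (simp add: wgt_def distrib_left exp_add)

lemma wgt_nat:
  assumes "q \<ge> 1"
  shows "wgt q (real x) = (1 + 1 / real q) ^ x"
proof -
  have "0 < 1 + 1 / real q" using assms by (simp add: add_pos_pos)
  then show ?thesis
    unfolding wgt_def by (simp add: mult.commute exp_of_nat_mult)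
qed

text \<open>A changed entry moves each imbalance by -1, 0 or 1; the second-order term pays for the
  downward step, as \<open>1 / (1 + 1/q) \<le> 1 - 1/q + 1/q^2\<close>.\<close>

lemma wgt_step:
  assumes "q \<ge> 1"
  shows "wgt q (x + (of_bool A - of_bool B)) \<le>
    wgt q x * (1 + (of_bool A - of_bool B) / real q + 1 / real q ^ 2)"
proof -
  have q: "real q \<ge> 1" using assms by simp
  have 1: "wgt q 1 = 1 + 1 / real q" using wgt_nat[OF assms, of 1] by simp
  have 0: "wgt q 0 = 1" by (simp add: wgt_def)
  have "wgt q (-1) * wgt q 1 = 1" by (simp add: 0 flip: wgt_add)
  then have "wgt q (-1) = 1 / (1 + 1 / real q)" using 1 wgt_pos[of q 1] by (simp add: field_simps)
  also have "\<dots> \<le> 1 - 1 / real q + 1 / real q ^ 2"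
    using q by (simp add: field_simps power2_eq_square)
  finally have m1: "wgt q (-1) \<le> 1 - 1 / real q + 1 / real q ^ 2" .
  have "wgt q (of_bool A - of_bool B) \<le> 1 + (of_bool A - of_bool B) / real q + 1 / real q ^ 2"
    using 0 1 m1 by (cases A; cases B) auto
  then show ?thesis
    unfolding wgt_add by (intro mult_left_mono) (auto intro: less_imp_le wgt_pos)
qed

section \<open>First-order analysis of column moves\<close>

context ucm begin

text \<open>The imbalance of a row at \<open>j\<close>. \<open>W\<close> and \<open>PhiR\<close> are
  the unscaled real potentials; \<open>rowpot\<close> and \<open>Phi\<close> differ from them by one
  positive factor, so comparisons carry over (\<open>Phi_le_iff\<close>).\<close>

definition ex :: "(nat \<Rightarrow> nat) \<Rightarrow> nat \<Rightarrow> real" where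
  "ex f j = real (cnt f j) - real (Suc j)"

definition W :: "nat \<Rightarrow> (nat \<Rightarrow> nat) \<Rightarrow> real" where
  "W q f = (\<Sum>j<m. wgt q (ex f j))"

definition PhiR :: "nat \<Rightarrow> (nat \<Rightarrow> nat \<Rightarrow> nat) \<Rightarrow> real" where
  "PhiR q S = (\<Sum>r<k. W q (S r))"

lemma real_cnt: "real (cnt f j) = (\<Sum>i<m. of_bool (f (Suc i) \<le> j))"
proof -
  have "{i. i < m \<and> f (Suc i) \<le> j} = {..<m} \<inter> {i. f (Suc i) \<le> j}" by auto
  then show ?thesis by (simp add: cnt_def of_bool_def sum.If_cases)
qed

lemma cnt_cong: "(\<And>i. i < m \<Longrightarrow> f (Suc i) = g (Suc i)) \<Longrightarrow> cnt f j = cnt g j"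
  unfolding cnt_def by (metis (no_types, lifting))

lemma W_cong: "(\<And>i. i < m \<Longrightarrow> f (Suc i) = g (Suc i)) \<Longrightarrow> W q f = W q g"
  unfolding W_def ex_def using cnt_cong[of f g] by simp

lemma real_rowpot:
  assumes "q \<ge> 1"
  shows "real (rowpot q f) = real q ^ (2 * m) * wgt q (real m) * W q f"
proof -
  have "real (weight q (m - Suc j + cnt f j)) = real q ^ (2 * m) * wgt q (real m) * wgt q (ex f j)"
    if "j < m" for j
  proof -
    let ?x = "m - Suc j + cnt f j"
    have x: "?x \<le> 2 * m" using cnt_le[of f j] that by linarith
    have "real (weight q ?x) = (1 + 1 / real q) ^ ?x * (real q ^ ?x * real q ^ (2 * m - ?x))"
      using assms unfolding weight_def
      by (simp add: power_mult_distrib[symmetric] field_simps del: power_Suc)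
    also have "real q ^ ?x * real q ^ (2 * m - ?x) = real q ^ (2 * m)"
      using x by (simp flip: power_add)
    also have "(1 + 1 / real q) ^ ?x = wgt q (real ?x)" using wgt_nat[OF assms] by (rule sym)
    also have "real ?x = real m + ex f j" using that by (simp add: ex_def)
    finally show ?thesis by (simp add: wgt_add mult_ac)
  qed
  then show ?thesis
    unfolding rowpot_def W_def by (simp add: sum_distrib_left)
qed

lemma Phi_le_iff:
  assumes "q \<ge> 1"
  shows "Phi q S \<le> Phi q S' \<longleftrightarrow> PhiR q S \<le> PhiR q S'"
proof -
  have "real (Phi q S) = real q ^ (2 * m) * wgt q (real m) * PhiR q S" for S
    unfolding Phi_def PhiR_def by (simp add: real_rowpot[OF assms] sum_distrib_left)
  then have "Phi q S \<le> Phi q S' \<longleftrightarrow>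
      real q ^ (2 * m) * wgt q (real m) * PhiR q S \<le> real q ^ (2 * m) * wgt q (real m) * PhiR q S'"
    by (metis of_nat_le_iff)
  moreover have "real q ^ (2 * m) * wgt q (real m) > 0" using assms wgt_pos by simp
  ultimately show ?thesis by (simp only: mult_le_cancel_left_pos)
qed

lemma ex_upd:
  assumes "i < m"
  shows "ex (f(Suc i := v)) j = ex f j + (of_bool (v \<le> j) - of_bool (f (Suc i) \<le> j))"
proof -
  have "(\<Sum>x\<in>{..<m} - {i}. of_bool ((f(Suc i := v)) (Suc x) \<le> j) :: real) =
      (\<Sum>x\<in>{..<m} - {i}. of_bool (f (Suc x) \<le> j))"
    by (intro sum.cong) auto
  moreover have "sum h {..<m} = h i + sum h ({..<m} - {i})" for h :: "nat \<Rightarrow> real"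
    using assms by (intro sum.remove) auto
  ultimately show ?thesis
    unfolding ex_def real_cnt by (simp only: fun_upd_same)
qed

text \<open>The single-entry moves towards \<open>g\<close>, each made from \<open>f\<close>, change
  the imbalance at \<open>j\<close> by \<open>ex g j - ex f j\<close> in total; the \<open>m\<close>
  second-order errors add up to \<open>m / q^2\<close>.\<close>

lemma row_moves:
  assumes "q \<ge> 1"
  shows "(\<Sum>i<m. W q (f(Suc i := g (Suc i))) - W q f) \<le>
    (\<Sum>j<m. wgt q (ex f j) * ((ex g j - ex f j) / real q + real m / real q ^ 2))"
proof -
  let ?d = "\<lambda>i j. of_bool (g (Suc i) \<le> j) - of_bool (f (Suc i) \<le> j) :: real"
  have "W q (f(Suc i := g (Suc i))) - W q f \<le>
      (\<Sum>j<m. wgt q (ex f j) * (?d i j / real q + 1 / real q ^ 2))" if "i < m" for i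
    unfolding W_def sum_subtractf[symmetric]
  proof (intro sum_mono)
    fix j
    show "wgt q (ex (f(Suc i := g (Suc i))) j) - wgt q (ex f j) \<le>
        wgt q (ex f j) * (?d i j / real q + 1 / real q ^ 2)"
      using wgt_step[OF assms, of "ex f j" "g (Suc i) \<le> j" "f (Suc i) \<le> j"]
      unfolding ex_upd[OF that] by (simp add: distrib_left add.assoc)
  qed
  then have "(\<Sum>i<m. W q (f(Suc i := g (Suc i))) - W q f) \<le>
      (\<Sum>i<m. \<Sum>j<m. wgt q (ex f j) * (?d i j / real q + 1 / real q ^ 2))"
    by (intro sum_mono) auto
  also have "\<dots> = (\<Sum>j<m. \<Sum>i<m. wgt q (ex f j) * (?d i j / real q + 1 / real q ^ 2))"
    by (rule sum.swap)
  also have "\<dots> = (\<Sum>j<m. wgt q (ex f j) * ((ex g j - ex f j) / real q + real m / real q ^ 2))"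
  proof (intro sum.cong refl)
    fix j
    have "(\<Sum>i<m. ?d i j) = ex g j - ex f j"
      unfolding ex_def real_cnt by (simp add: sum_subtractf)
    then show "(\<Sum>i<m. wgt q (ex f j) * (?d i j / real q + 1 / real q ^ 2)) =
        wgt q (ex f j) * ((ex g j - ex f j) / real q + real m / real q ^ 2)"
      by (simp add: sum_distrib_left[symmetric] sum.distrib sum_divide_distrib[symmetric])
  qed
  finally show ?thesis .
qed

text \<open>\<open>S\<close> is an approximate local optimum: no column move gains more than the
  fraction \<open>1 / (k * q^2)\<close> of the potential. Summing over all columns the moves to the
  columns of \<open>G\<close>, and the moves swapping the entries of two rows, gives the two
  conditions of \<open>balanced_loads\<close>.\<close>

lemma local_optimum_balanced:
  assumes q: "q \<ge> 1" "q ^ 2 \<le> m" and k: "k \<ge> 1"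
    and S: "\<And>i. i < m \<Longrightarrow> feas \<tau> i (\<lambda>r. S r (Suc i))"
    and G: "\<And>i. i < m \<Longrightarrow> feas \<tau> i (\<lambda>r. G r (Suc i))" "\<And>r j. r < k \<Longrightarrow> j < m \<Longrightarrow> ex (G r) j = 0"
    and opt: "\<And>i vs. i < m \<Longrightarrow> feas \<tau> i vs \<Longrightarrow>
      PhiR q S - PhiR q S / (real k * real q ^ 2) \<le> PhiR q (setcol S i vs)"
    and rj: "r < k" "j < m"
  shows "wgt q (ex (S r) j) \<le> 20 * real m ^ 2 * exp (27 * real m / real q ^ 2)"
proof -
  let ?eps = "PhiR q S / (real k * real q ^ 2)"
  have moves: "- real m * ?eps \<le> (\<Sum>i<m. PhiR q (setcol S i (vs i)) - PhiR q S)"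
    if "\<And>i. i < m \<Longrightarrow> feas \<tau> i (vs i)" for vs
  proof -
    have "(\<Sum>i<m. - ?eps) \<le> (\<Sum>i<m. PhiR q (setcol S i (vs i)) - PhiR q S)"
      using opt that by (intro sum_mono) fastforce
    then show ?thesis by simp
  qed
  have A: "- real m * ?eps \<le>
     (\<Sum>r<k. \<Sum>j<m. wgt q (ex (S r) j) * ((0 - ex (S r) j) / real q + real m / real q ^ 2))"
  proof -
    have "- real m * ?eps \<le> (\<Sum>i<m. PhiR q (setcol S i (\<lambda>r. G r (Suc i))) - PhiR q S)"
      by (intro moves G)
    also have "\<dots> = (\<Sum>i<m. \<Sum>r<k. W q ((S r)(Suc i := G r (Suc i))) - W q (S r))"
      by (simp add: PhiR_def setcol_def sum_subtractf)
    also have "\<dots> = (\<Sum>r<k. \<Sum>i<m. W q ((S r)(Suc i := G r (Suc i))) - W q (S r))"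
      by (rule sum.swap)
    also have "\<dots> \<le> (\<Sum>r<k. \<Sum>j<m. wgt q (ex (S r) j) * ((ex (G r) j - ex (S r) j) / real q + real m / real q ^ 2))"
      by (intro sum_mono row_moves q)
    also have "\<dots> = (\<Sum>r<k. \<Sum>j<m. wgt q (ex (S r) j) * ((0 - ex (S r) j) / real q + real m / real q ^ 2))"
      by (intro sum.cong refl) (simp add: G)
    finally show ?thesis .
  qed
  have B: "- real m * ?eps \<le>
     (\<Sum>j<m. wgt q (ex (S r) j) * ((ex (S r') j - ex (S r) j) / real q + real m / real q ^ 2)) +
     (\<Sum>j<m. wgt q (ex (S r') j) * ((ex (S r) j - ex (S r') j) / real q + real m / real q ^ 2))"
    if r: "r < k" "r' < k" for r r'
  proof (cases "r = r'")
    case True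
    have "PhiR q S \<ge> 0" unfolding PhiR_def W_def by (intro sum_nonneg) (auto intro: less_imp_le wgt_pos)
    then have "- real m * ?eps \<le> 0" by (simp add: mult_nonneg_nonneg)
    also have "0 \<le> 2 * (\<Sum>j<m. wgt q (ex (S r) j) * (real m / real q ^ 2))"
      by (intro mult_nonneg_nonneg[of 2] sum_nonneg mult_nonneg_nonneg) (auto intro: less_imp_le wgt_pos)
    finally show ?thesis using True by simp
  next
    case False
    let ?t = "Transposition.transpose r r'"
    have perm: "?t permutes {..<k}" using r by (intro permutes_swap_id) auto
    \<comment> \<open>A swap only permutes the summands of a column's cost, so it stays within the
      budget.\<close>
    have "feas \<tau> i (\<lambda>x. S (?t x) (Suc i))" if "i < m" for i
    proof -
      have "(\<Sum>x<k. a (S (?t x) (Suc i)) - a 0) = (\<Sum>x<k. a (S x (Suc i)) - a 0)"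
        using sum.permute[OF perm, of "\<lambda>x. a (S x (Suc i)) - a 0"] by (simp add: o_def)
      moreover have "?t x < k" if "x < k" for x
        using permutes_in_image[OF perm, of x] that by simp
      ultimately show ?thesis using S[OF that] by (simp add: feas_def)
    qed
    then have "- real m * ?eps \<le> (\<Sum>i<m. PhiR q (setcol S i (\<lambda>x. S (?t x) (Suc i))) - PhiR q S)"
      by (intro moves)
    also have "\<dots> = (\<Sum>i<m. (W q ((S r)(Suc i := S r' (Suc i))) - W q (S r)) +
        (W q ((S r')(Suc i := S r (Suc i))) - W q (S r')))"
    proof (intro sum.cong refl)
      fix i
      have "PhiR q (setcol S i (\<lambda>x. S (?t x) (Suc i))) - PhiR q S =
          (\<Sum>x<k. W q ((S x)(Suc i := S (?t x) (Suc i))) - W q (S x))"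
        by (simp add: PhiR_def setcol_def sum_subtractf)
      also have "\<dots> = (\<Sum>x\<in>{r, r'}. W q ((S x)(Suc i := S (?t x) (Suc i))) - W q (S x))"
        using r by (intro sum.mono_neutral_right) (auto simp: transpose_def)
      also have "\<dots> = (W q ((S r)(Suc i := S r' (Suc i))) - W q (S r)) +
        (W q ((S r')(Suc i := S r (Suc i))) - W q (S r'))"
        using False by simp
      finally show "PhiR q (setcol S i (\<lambda>x. S (?t x) (Suc i))) - PhiR q S = \<dots>" .
    qed
    also have "\<dots> \<le> (\<Sum>j<m. wgt q (ex (S r) j) * ((ex (S r') j - ex (S r) j) / real q + real m / real q ^ 2)) +
     (\<Sum>j<m. wgt q (ex (S r') j) * ((ex (S r) j - ex (S r') j) / real q + real m / real q ^ 2))"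
      unfolding sum.distrib by (intro add_mono row_moves q)
    finally show ?thesis .
  qed
  have "real q ^ 2 \<le> real m" using q(2) by (metis of_nat_le_iff of_nat_power)
  then show ?thesis
    using balanced_loads[of "real q" m k "\<lambda>r. ex (S r)" r j] q(1) k A B rj
    unfolding wgt_def PhiR_def W_def by simp
qed

end

text \<open>With \<open>q\<close> near \<open>sqrt (m / (2 * ln m))\<close> the exponent
  \<open>27 * m / q^2\<close> is of order \<open>ln m\<close>, so the weight bound is polynomial in
  \<open>m\<close>; its logarithm to base \<open>1 + 1/q\<close> is of order
  \<open>q * ln m\<close>, that is \<open>sqrt (m * ln m)\<close>.\<close>

lemma choose_base:
  assumes "m \<ge> 2"
  obtains q where "1 \<le> q" "q ^ 2 \<le> m"
    "\<And>x. wgt q x \<le> 20 * real m ^ 2 * exp (27 * real m / real q ^ 2) \<Longrightarrow> x \<le> real (beta 447 m)"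
proof -
  define L where "L = ln (real m)"
  have m: "real m \<ge> 2" using assms by simp
  have L2: "ln 2 \<le> L" using m by (simp add: L_def)
  have "ln 2 \<ge> (2 / 3 :: real)" by (rule ln2_ge_two_thirds)
  with L2 have L: "L \<ge> 1 / 2" "L > 0" by linarith+
  have "ln (real m / 2) \<le> real m / 2 - 1" using m by (intro ln_le_minus_one) auto
  moreover have "ln (real m / 2) = L - ln 2" using m by (simp add: L_def ln_div)
  moreover have "ln 2 \<le> (1 :: real)" using ln_le_minus_one[of 2] by simp
  ultimately have Lm: "L \<le> real m / 2" by linarith
  define y where "y = sqrt (real m / (2 * L))"
  have y1: "y \<ge> 1" using Lm L by (simp add: y_def)
  have y2: "y ^ 2 = real m / (2 * L)" using L m by (simp add: y_def)
  define q where "q = nat \<lfloor>y\<rfloor>"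
  have qy: "real q \<le> y" "y < real q + 1" using y1 by (auto simp: q_def)
  have q1: "q \<ge> 1" using y1 by (simp add: q_def le_nat_iff)
  have "real (q ^ 2) \<le> y ^ 2" using qy by (simp add: power_mono)
  also have "\<dots> \<le> real m" unfolding y2 using L m by (simp add: field_simps)
  finally have qm: "q ^ 2 \<le> m" by simp
  \<comment> \<open>Since \<open>q \<ge> 1\<close>, rounding \<open>y\<close> down loses at most a
    factor 2.\<close>
  have "y / 2 \<le> real q" using qy q1 by linarith
  then have "(y / 2) ^ 2 \<le> real q ^ 2" using y1 by (intro power_mono) auto
  then have "real m / (8 * L) \<le> real q ^ 2" using y2 by (simp add: power_divide)
  then have mq: "real m / real q ^ 2 \<le> 8 * L" using L q1 by (simp add: field_simps)
  define s where "s = sqrt (real m * L)"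
  have "1 \<le> real m * L" using mult_mono[of 2 "real m" "1/2" L] m L by simp
  then have s1: "s \<ge> 1" by (simp add: s_def)
  have "y * L = sqrt (real m / (2 * L) * L ^ 2)" using L unfolding y_def real_sqrt_mult by simp
  also have "\<dots> \<le> s" unfolding s_def using L m by (intro real_sqrt_le_mono) (simp add: field_simps power2_eq_square)
  finally have yL: "y * L \<le> s" .
  \<comment> \<open>The spare unit in 447 pays for the rounding in \<open>beta\<close>, as
    \<open>s \<ge> 1\<close>.\<close>
  have beta: "446 * s \<le> real (beta 447 m)"
  proof -
    have "446 * s \<le> 447 * s - 1 / 2" using s1 by linarith
    also have "\<dots> \<le> of_int (round (447 * s))" by (rule of_int_round_ge)
    also have "\<dots> \<le> real (nat (round (447 * s)))" by linarith
    finally show ?thesis by (simp add: beta_def s_def L_def)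
  qed
  have "x \<le> real (beta 447 m)" if *: "wgt q x \<le> 20 * real m ^ 2 * exp (27 * real m / real q ^ 2)" for x
  proof (cases "x \<le> 0")
    case False
    define l where "l = ln (1 + 1 / real q)"
    have l: "1 / (2 * real q) \<le> l" using ln_one_plus_inverse_bounds[of "real q"] q1 by (simp add: l_def)
    have "l * x \<le> ln (20 * real m ^ 2 * exp (27 * real m / real q ^ 2))"
      using * m by (subst ln_ge_iff) (auto simp: wgt_def l_def)
    also have "\<dots> = ln 20 + 2 * L + 27 * (real m / real q ^ 2)"
      using m by (simp add: ln_mult ln_realpow L_def)
    \<comment> \<open>\<open>20 \<le> 2^5\<close> gives \<open>ln 20 \<le> 5 * L\<close>, and
      \<open>8 * L\<close> bounds \<open>m / q^2\<close>; the total 223 is doubled to 446 by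
      \<open>l \<ge> 1 / (2 * q)\<close>.\<close>
    also have "\<dots> \<le> 5 * L + 2 * L + 27 * (8 * L)"
    proof -
      have "ln 20 \<le> ln ((2::real) ^ 5)" by simp
      also have "\<dots> = 5 * ln 2" by (subst ln_realpow) auto
      finally have "ln 20 \<le> 5 * L" using L2 by simp
      then show ?thesis using mq by (intro add_mono mult_left_mono) auto
    qed
    finally have "l * x \<le> 223 * L" by simp
    moreover have "1 / (2 * real q) * x \<le> l * x" using l False by (intro mult_right_mono) auto
    ultimately have "1 / (2 * real q) * x \<le> 223 * L" by linarith
    then have "x \<le> 446 * (real q * L)" using q1 by (simp add: field_simps)
    also have "\<dots> \<le> 446 * (y * L)" using qy L by (intro mult_left_mono mult_right_mono) auto
    also have "\<dots> \<le> 446 * s" using yL by simp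
    finally show ?thesis using beta by simp
  qed auto
  with q1 qm that show thesis by blast
qed

section \<open>Convergence of the local search\<close>

context ucm begin

text \<open>Equality of the entries that matter: a matrix read off an array has uncontrolled values
  outside the \<open>k\<close> by \<open>m + 1\<close> range.\<close>

definition near :: "(nat \<Rightarrow> nat \<Rightarrow> nat) \<Rightarrow> (nat \<Rightarrow> nat \<Rightarrow> nat) \<Rightarrow> bool" where
  "near S S' \<longleftrightarrow> (\<forall>r<k. \<forall>i\<le>m. S r i = S' r i)"

definition trajectory :: "nat \<Rightarrow> nat \<Rightarrow> nat \<Rightarrow> (nat \<Rightarrow> nat \<Rightarrow> nat \<Rightarrow> nat) \<Rightarrow> bool" where
  "trajectory \<tau> q n Y \<longleftrightarrow> near (Y 0) start \<and>
     (\<forall>t<n. \<exists>i vs. best_step \<tau> q (Y t) i vs m \<and> near (Y (Suc t)) (setcol (Y t) i vs))"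

lemma PhiR_near: "near S S' \<Longrightarrow> PhiR q S = PhiR q S'"
  unfolding PhiR_def near_def by (intro sum.cong refl W_cong) auto

lemma feas_cong: "(\<And>r. r < k \<Longrightarrow> vs r = vs' r) \<Longrightarrow> feas \<tau> i vs \<longleftrightarrow> feas \<tau> i vs'"
  unfolding feas_def by (metis (mono_tags, lifting) lessThan_iff sum.cong)

lemma trajectory_inv:
  assumes "trajectory \<tau> q n Y" "t \<le> n"
  shows "(\<forall>i<m. feas \<tau> i (\<lambda>r. Y t r (Suc i))) \<and> (\<forall>r<k. Y t r 0 = m)"
  using assms(2)
proof (induction t)
  case 0
  have n: "near (Y 0) start" using assms(1) by (simp add: trajectory_def)
  have "feas \<tau> i (\<lambda>r. Y 0 r (Suc i))" if "i < m" for i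
    using n that m_pos by (subst feas_cong[of _ "\<lambda>_. 0"]) (auto simp: near_def start_def feas_def)
  then show ?case using n by (auto simp: near_def start_def)
next
  case (Suc t)
  then obtain i vs where b: "best_step \<tau> q (Y t) i vs m" and n: "near (Y (Suc t)) (setcol (Y t) i vs)"
    using assms(1) unfolding trajectory_def by (meson Suc_le_eq)
  have "feas \<tau> i' (\<lambda>r. Y (Suc t) r (Suc i'))" if "i' < m" for i'
  proof (cases "i' = i")
    case True
    then show ?thesis
      using b n that by (subst feas_cong[of _ vs]) (auto simp: near_def setcol_def best_step_def)
  next
    case False
    then show ?thesis
      using Suc n that by (subst feas_cong[of _ "\<lambda>r. Y t r (Suc i')"]) (auto simp: near_def setcol_def)
  qed
  then show ?case using Suc n by (auto simp: near_def setcol_def)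
qed

lemma W_bounds:
  assumes "q \<ge> 1"
  shows "real m * wgt q (- real m) \<le> W q f" "W q f \<le> real m * wgt q (real m)"
proof -
  have l: "ln (1 + 1 / real q) \<ge> 0" using assms by simp
  have "wgt q (- real m) \<le> wgt q (ex f j) \<and> wgt q (ex f j) \<le> wgt q (real m)" if "j < m" for j
  proof -
    have "- real m \<le> ex f j" "ex f j \<le> real m"
      using that cnt_le[of f j] by (auto simp: ex_def)
    then show ?thesis
      unfolding wgt_def exp_le_cancel_iff using l by (blast intro: mult_left_mono)
  qed
  then show "real m * wgt q (- real m) \<le> W q f" "W q f \<le> real m * wgt q (real m)"
    unfolding W_def using sum_bounded_below[of "{..<m}" "wgt q (- real m)" "\<lambda>j. wgt q (ex f j)"]
      sum_bounded_above[of "{..<m}" "\<lambda>j. wgt q (ex f j)" "wgt q (real m)"] by auto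
qed

text \<open>Otherwise every state violates the weight bound, hence is no approximate local optimum,
  and each step multiplies the potential by at most \<open>1 - 1/(k * q^2)\<close>. Over
  \<open>R\<close> steps this is a factor of at most \<open>exp (- 3 * m)\<close>, while all
  potentials lie within a factor \<open>(1 + 1/q)^(2 * m) \<le> exp (2 * m)\<close> of one
  another.\<close>

lemma trajectory_balanced:
  assumes q: "q \<ge> 1" "q ^ 2 \<le> m" and k: "k \<ge> 1"
    and Y: "trajectory \<tau> q R Y"
    and G: "\<And>i. i < m \<Longrightarrow> feas \<tau> i (\<lambda>r. G r (Suc i))" "\<And>r j. r < k \<Longrightarrow> j < m \<Longrightarrow> ex (G r) j = 0"
  shows "\<exists>t<R. \<forall>r<k. \<forall>j<m. wgt q (ex (Y t r) j) \<le> 20 * real m ^ 2 * exp (27 * real m / real q ^ 2)"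
proof (rule ccontr)
  assume bad: "\<not> ?thesis"
  define c where "c = 1 / (real k * real q ^ 2)"
  have kq: "real k * real q ^ 2 \<ge> 1" using k q by (smt (verit) mult_le_cancel_left1 of_nat_1 of_nat_le_iff one_le_power)
  then have c: "0 \<le> 1 - c" by (simp add: c_def)
  have dec: "PhiR q (Y (Suc t)) \<le> (1 - c) * PhiR q (Y t)" if "t < R" for t
  proof -
    obtain r j where rj: "r < k" "j < m" "\<not> wgt q (ex (Y t r) j) \<le> 20 * real m ^ 2 * exp (27 * real m / real q ^ 2)"
      using bad \<open>t < R\<close> by meson
    have "\<not> (\<forall>i vs. i < m \<longrightarrow> feas \<tau> i vs \<longrightarrow>
        PhiR q (Y t) - PhiR q (Y t) / (real k * real q ^ 2) \<le> PhiR q (setcol (Y t) i vs))"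
      using local_optimum_balanced[OF q k, of \<tau> "Y t" G r j] trajectory_inv[OF Y, of t] that G rj by auto
    then obtain i vs where i: "i < m" "feas \<tau> i vs"
      "PhiR q (setcol (Y t) i vs) < PhiR q (Y t) - PhiR q (Y t) / (real k * real q ^ 2)" by (meson not_le)
    obtain i' vs' where "best_step \<tau> q (Y t) i' vs' m" "near (Y (Suc t)) (setcol (Y t) i' vs')"
      using Y \<open>t < R\<close> unfolding trajectory_def by meson
    then have "PhiR q (Y (Suc t)) \<le> PhiR q (setcol (Y t) i vs)"
      using i by (auto simp: PhiR_near best_step_def Phi_le_iff[OF q(1)])
    with i(3) show ?thesis by (simp add: c_def algebra_simps)
  qed
  have "PhiR q (Y t) \<le> (1 - c) ^ t * PhiR q (Y 0)" if "t \<le> R" for t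
    using that
  proof (induction t)
    case (Suc t)
    have "PhiR q (Y (Suc t)) \<le> (1 - c) * PhiR q (Y t)" using Suc by (intro dec) auto
    also have "\<dots> \<le> (1 - c) * ((1 - c) ^ t * PhiR q (Y 0))" using Suc c by (intro mult_left_mono) auto
    finally show ?case by (simp add: mult.assoc)
  qed simp
  from this[OF order.refl] have 1: "PhiR q (Y R) \<le> (1 - c) ^ R * PhiR q (Y 0)" .
  have lo: "real k * (real m * wgt q (- real m)) \<le> PhiR q (Y R)"
    unfolding PhiR_def using sum_bounded_below[of "{..<k}" "real m * wgt q (- real m)"] W_bounds[OF q(1)] by simp
  have hi: "PhiR q (Y 0) \<le> real k * (real m * wgt q (real m))"
    unfolding PhiR_def using sum_bounded_above[of "{..<k}" _ "real m * wgt q (real m)"] W_bounds[OF q(1)] by simp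
  have "(1 - c) ^ R \<le> exp (- c) ^ R"
    using exp_ge_add_one_self[of "- c"] c by (intro power_mono) auto
  also have "\<dots> = exp (- (real R * c))" by (simp flip: exp_of_nat_mult)
  also have "\<dots> \<le> exp (- (3 * real m))"
  proof -
    have q2: "real q ^ 2 \<le> real m" using q(2) by (metis of_nat_le_iff of_nat_power)
    have "3 * real m * (real k * real q ^ 2) \<le> 3 * real m * (real k * real m)"
      using q2 by (intro mult_left_mono) auto
    also have "\<dots> = real R" by (simp add: R_def)
    finally have "3 * real m \<le> real R * c" using kq by (simp add: c_def field_simps)
    then show ?thesis by simp
  qed
  finally have pw: "(1 - c) ^ R \<le> exp (- (3 * real m))" .
  have "real k * (real m * wgt q (- real m)) \<le> exp (- (3 * real m)) * (real k * (real m * wgt q (real m)))"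
    using lo 1 mult_mono[OF pw hi] c W_bounds[OF q(1)]
    by (smt (verit) exp_ge_zero mult_nonneg_nonneg of_nat_0_le_iff wgt_pos zero_le_power PhiR_def sum_nonneg)
  then have "(real k * real m) * wgt q (- real m) \<le> (real k * real m) * (exp (- (3 * real m)) * wgt q (real m))"
    by (simp add: mult_ac)
  moreover have "real k * real m > 0" using k m_pos by simp
  ultimately have "wgt q (- real m) \<le> exp (- (3 * real m)) * wgt q (real m)"
    by (simp only: mult_le_cancel_left_pos)
  then have "3 * real m \<le> 2 * (ln (1 + 1 / real q) * real m)"
    unfolding wgt_def exp_add[symmetric] exp_le_cancel_iff by (simp add: mult.commute)
  moreover have "ln (1 + 1 / real q) \<le> 1"
    using ln_one_plus_inverse_bounds(2)[of "real q"] q(1) by (smt (verit) divide_le_eq_1 of_nat_1 of_nat_le_iff)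
  then have "ln (1 + 1 / real q) * real m \<le> 1 * real m" by (intro mult_right_mono) auto
  ultimately show False using m_pos by simp
qed

section \<open>Bounds on the optimum, and rounding of balanced matrices\<close>

lemma max_score_ge: "i \<in> {1..m} \<Longrightarrow> score a \<sigma> k S i \<le> max_score a m \<sigma> k S"
  unfolding max_score_def by (intro Max_ge) auto

lemma max_score_le_iff: "max_score a m \<sigma> k S \<le> B \<longleftrightarrow> (\<forall>i\<in>{1..m}. score a \<sigma> k S i \<le> B)"
  unfolding max_score_def using m_pos by (subst Max_le_iff) auto

lemma sigma_le: "i \<in> {1..m} \<Longrightarrow> \<sigma> i \<le> sm"
  unfolding sm_def by (intro Max_ge) auto

lemma strategies_range: "S \<in> strategies m k \<Longrightarrow> r < k \<Longrightarrow> i \<le> m \<Longrightarrow> S r i \<le> m"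
  using bij_betwE[of "S r" "{0..m}" "{0..m}"] by (auto simp: strategies_def)

text \<open>Limits the guesses for \<open>\<tau>\<close> to \<open>0..K\<close>, and puts
  \<open>sm + K + 1\<close> above the score of every strategy.\<close>

lemma max_score_le:
  assumes "S \<in> strategies m k"
  shows "max_score a m \<sigma> k S \<le> sm + K"
  unfolding max_score_le_iff
proof
  fix i assume i: "i \<in> {1..m}"
  have "(\<Sum>r<k. a (S r i)) \<le> (\<Sum>r<k. a m)"
    using strategies_range[OF assms] i mono by (intro sum_mono) (auto simp: mono_on_def)
  then show "score a \<sigma> k S i \<le> sm + K"
    using sigma_le[OF i] by (simp add: score_def K_def)
qed

text \<open>The candidate with the largest initial score receives at least \<open>a 0\<close> from
  each manipulator. Hence the subtraction of \<open>sm\<close> and \<open>k * a 0\<close> from the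
  optimum is not truncated.\<close>

lemma max_score_ge_sm:
  assumes "S \<in> strategies m k"
  shows "sm + k * a 0 \<le> max_score a m \<sigma> k S"
proof -
  have "sm \<in> \<sigma> ` {1..m}" unfolding sm_def using m_pos by (intro Max_in) auto
  then obtain i where i: "i \<in> {1..m}" "sm = \<sigma> i" by auto
  have "(\<Sum>r<k. a 0) \<le> (\<Sum>r<k. a (S r i))"
    using strategies_range[OF assms] i a0_le by (intro sum_mono) auto
  then have "sm + k * a 0 \<le> score a \<sigma> k S i" by (simp add: score_def i)
  with max_score_ge[OF i(1), of S] show ?thesis by linarith
qed

lemma opt_strategy:
  obtains S where "S \<in> strategies m k" "max_score a m \<sigma> k S = opt_score a m \<sigma> k"
proof -
  have "(\<lambda>_ i. i) \<in> strategies m k" by (simp add: strategies_def bij_betw_def inj_on_def)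
  \<comment> \<open>There are infinitely many strategies, as the functions are free outside the
    range of rows and candidates; the minimum exists because the scores are bounded.\<close>
  moreover have "finite (max_score a m \<sigma> k ` strategies m k)"
    by (rule finite_subset[of _ "{..sm + K}"]) (auto intro: max_score_le)
  ultimately have "opt_score a m \<sigma> k \<in> max_score a m \<sigma> k ` strategies m k"
    unfolding opt_score_def by (intro Min_in) auto
  then show thesis using that by auto
qed

text \<open>Exchanging indices so that candidate 0 always gets the index \<open>m\<close> does not increase any other score.\<close>

lemma normalized_optimum:
  defines "T \<equiv> opt_score a m \<sigma> k"
  obtains G where "\<And>i. i < m \<Longrightarrow> feas (T - sm - k * a 0) i (\<lambda>r. G r (Suc i))"
    "\<And>r j. r < k \<Longrightarrow> j < m \<Longrightarrow> ex (G r) j = 0"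
proof -
  obtain S where S: "S \<in> strategies m k" "max_score a m \<sigma> k S = T"
    using opt_strategy by (auto simp: T_def)
  have bij: "bij_betw (S r) {0..m} {0..m}" if "r < k" for r using S(1) that by (simp add: strategies_def)
  have "\<exists>i0. r < k \<longrightarrow> i0 \<le> m \<and> S r i0 = m" for r
  proof (cases "r < k")
    case True
    then have "m \<in> S r ` {0..m}" using bij[OF True] by (simp add: bij_betw_def)
    then show ?thesis by auto
  qed simp
  then obtain top where top: "\<And>r. r < k \<Longrightarrow> top r \<le> m \<and> S r (top r) = m" by metis
  define G where "G = (\<lambda>r i. S r (Transposition.transpose 0 (top r) i))"
  have bijG: "bij_betw (G r) {0..m} {0..m}" if "r < k" for r
  proof -
    have "bij_betw (Transposition.transpose 0 (top r)) {0..m} {0..m}"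
      using top[OF that] by (intro permutes_imp_bij permutes_swap_id) auto
    from bij_betw_trans[OF this bij[OF that]] show ?thesis by (simp add: G_def o_def)
  qed
  have G0: "G r 0 = m" if "r < k" for r using top[OF that] by (simp add: G_def)
  have Gm: "G r i < m" if "r < k" "1 \<le> i" "i \<le> m" for r i
  proof -
    have "G r i \<le> m" using bij_betwE[OF bijG[OF that(1)]] that by auto
    moreover have "G r i \<noteq> G r 0"
      using that by (subst inj_on_eq_iff[OF bij_betw_imp_inj_on[OF bijG]]) auto
    ultimately show ?thesis using G0[OF that(1)] by simp
  qed
  have aG: "a (G r i) \<le> a (S r i)" if "r < k" "1 \<le> i" "i \<le> m" for r i
  proof (cases "i = top r")
    case True
    then have "G r i \<le> S r i" using Gm[OF that] top[OF that(1)] by simp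
    then show ?thesis using mono Gm[OF that] top[OF that(1)] True by (auto simp: mono_on_def)
  next
    case False
    then show ?thesis using that by (simp add: G_def transpose_def)
  qed
  have lo: "sm + k * a 0 \<le> T" using max_score_ge_sm[OF S(1)] S(2) by simp
  have f: "feas (T - sm - k * a 0) i (\<lambda>r. G r (Suc i))" if "i < m" for i
  proof -
    have r: "a 0 \<le> a (G r (Suc i))" "G r (Suc i) < m" "a (G r (Suc i)) \<le> a m" if "r < k" for r
      using Gm[OF that, of "Suc i"] \<open>i < m\<close> a0_le mono by (auto simp: mono_on_def)
    have "(\<Sum>r<k. a (G r (Suc i)) - a 0) = (\<Sum>r<k. a (G r (Suc i))) - (\<Sum>r<k. a 0)"
      using r by (intro sum_subtractf_nat) auto
    moreover have "(\<Sum>r<k. a (G r (Suc i))) \<le> (\<Sum>r<k. a (S r (Suc i)))"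
      using aG that by (intro sum_mono) auto
    moreover have "\<sigma> (Suc i) + (\<Sum>r<k. a (S r (Suc i))) \<le> T"
      using max_score_ge[of "Suc i" S] that S(2) by (simp add: score_def)
    moreover have "(\<Sum>r<k. a (G r (Suc i)) - a 0) \<le> (\<Sum>r<k. a m)"
      using r by (intro sum_mono) (auto simp: le_diff_conv trans_le_add1)
    ultimately show ?thesis
      using lo r sigma_le[of "Suc i"] that by (auto simp: feas_def cap_def K_def)
  qed
  have "ex (G r) j = 0" if "r < k" "j < m" for r j
  proof -
    \<comment> \<open>Row \<open>r\<close> is a permutation with index \<open>m\<close> at candidate
      0, so the indices \<open>0..j\<close> all lie at the candidates \<open>1..m\<close>.\<close>
    have "bij_betw (\<lambda>i. G r (Suc i)) {i. i < m \<and> G r (Suc i) \<le> j} {..j}"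
      unfolding bij_betw_def
    proof (intro conjI equalityI subsetI)
      show "inj_on (\<lambda>i. G r (Suc i)) {i. i < m \<and> G r (Suc i) \<le> j}"
        using bij_betw_imp_inj_on[OF bijG[OF that(1)]]
        by (intro inj_onI) (auto dest: inj_onD)
      fix v assume v: "v \<in> {..j}"
      then have "v \<in> G r ` {0..m}" using bijG[OF that(1)] that by (auto simp: bij_betw_def)
      then obtain i where i: "i \<le> m" "G r i = v" by auto
      with v that G0[OF that(1)] have "i \<noteq> 0" by (metis atMost_iff not_le)
      with i v show "v \<in> (\<lambda>i. G r (Suc i)) ` {i. i < m \<and> G r (Suc i) \<le> j}"
        by (intro image_eqI[of _ _ "i - 1"]) auto
    qed auto
    then have "cnt (G r) j = card {..j}" unfolding cnt_def by (rule bij_betw_same_card)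
    then show ?thesis by (simp add: ex_def)
  qed
  with f that show thesis by blast
qed

lemma srank_le: "i \<le> m \<Longrightarrow> srank S r i \<le> m"
proof -
  assume "i \<le> m"
  have "srank S r i \<le> card ({0..m} - {i})"
    unfolding srank_def by (intro card_mono) auto
  then show ?thesis using \<open>i \<le> m\<close> by simp
qed

text \<open>The rank is strictly monotone in the lexicographic order, hence injective on a finite
  set that it maps into itself.\<close>

lemma srank_strategies: "srank S \<in> strategies m k"
proof -
  have less: "srank S r i < srank S r i'"
    if "i \<le> m" "S r i < S r i' \<or> S r i = S r i' \<and> i < i'" for r i i'
  proof -
    let ?A = "\<lambda>i. {x. x < Suc m \<and> (S r x < S r i \<or> S r x = S r i \<and> x < i)}"
    have "?A i \<subseteq> ?A i'"
    proof
      fix x assume "x \<in> ?A i"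
      then show "x \<in> ?A i'" using that(2) by (simp, linarith)
    qed
    moreover have "i \<in> ?A i'" "i \<notin> ?A i" using that by auto
    ultimately have "?A i \<subset> ?A i'" by blast
    then show ?thesis unfolding srank_def by (intro psubset_card_mono) auto
  qed
  have "inj_on (srank S r) {0..m}" for r
  proof (rule inj_onI)
    fix i i' assume "i \<in> {0..m}" "i' \<in> {0..m}" "srank S r i = srank S r i'"
    then show "i = i'"
      using less[of i r i'] less[of i' r i] by (metis atLeastAtMost_iff less_irrefl linorder_neqE_nat)
  qed
  moreover have "srank S r ` {0..m} \<subseteq> {0..m}" for r using srank_le by auto
  ultimately show ?thesis
    unfolding strategies_def bij_betw_def using endo_inj_surj[of "{0..m}"] by blast
qed

lemma gap_ge:
  assumes "v \<le> x" "x \<le> v + \<beta>" "x \<le> m" "\<beta> \<le> m"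
  shows "int (a x) \<le> int (a v) + gap a m \<beta>"
proof -
  \<comment> \<open>The window of length \<open>\<beta>\<close> starting at \<open>v\<close> may
    leave the range; moving it left to \<open>u\<close> keeps \<open>x\<close> below its upper
    end.\<close>
  define u where "u = min v (m - \<beta>)"
  have u: "u \<le> v" "x \<le> u + \<beta>" "u + \<beta> \<le> m" using assms by (auto simp: u_def)
  have "\<bar>int (a (u + \<beta>)) - int (a u)\<bar> \<le> gap a m \<beta>"
    unfolding gap_def by (intro Max_ge) (auto simp: u_def)
  moreover have "a x \<le> a (u + \<beta>)" "a u \<le> a v"
    using u assms mono by (auto simp: mono_on_def)
  ultimately show ?thesis by linarith
qed

text \<open>Only candidates other than 0 with index at most \<open>v\<close> can precede a candidate
  of index \<open>v\<close>, and there are at most \<open>v + 1 + \<beta>\<close> of them, itself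
  included. So sorting raises an index by at most \<open>\<beta>\<close>, and one manipulator's
  score by at most the gap.\<close>

lemma balanced_max_score:
  assumes \<beta>: "\<beta> \<le> m"
    and S: "\<And>i. i < m \<Longrightarrow> feas \<tau> i (\<lambda>r. S r (Suc i))" "\<And>r. r < k \<Longrightarrow> S r 0 = m"
    and bal: "\<And>r j. r < k \<Longrightarrow> j < m \<Longrightarrow> ex (S r) j \<le> real \<beta>"
  shows "int (max_score a m \<sigma> k (srank S)) \<le> int (sm + k * a 0 + \<tau>) + int k * gap a m \<beta>"
proof -
  have "int (score a \<sigma> k (srank S) i) \<le> int (sm + k * a 0 + \<tau>) + int k * gap a m \<beta>"
    if i: "i \<in> {1..m}" for i
  proof -
    obtain i' where i': "i = Suc i'" "i' < m" using i by (cases i) auto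
    have f: "feas \<tau> i' (\<lambda>r. S r i)" using S(1)[OF i'(2)] i'(1) by simp
    have each: "int (a (srank S r i)) \<le> int (a 0 + (a (S r i) - a 0)) + gap a m \<beta>" if r: "r < k" for r
    proof -
      define v where "v = S r i"
      have v: "v < m" using f r by (simp add: feas_def v_def)
      have sub: "{x. x < Suc m \<and> (S r x < S r i \<or> S r x = S r i \<and> x < i)} \<subseteq>
          Suc ` {x. x < m \<and> S r (Suc x) \<le> v} - {i}"
      proof
        fix x assume x: "x \<in> {x. x < Suc m \<and> (S r x < S r i \<or> S r x = S r i \<and> x < i)}"
        then have "S r x \<le> v" by (auto simp: v_def)
        then have "S r x \<noteq> S r 0" using v S(2)[OF r] by simp
        then have "x \<noteq> 0" by metis
        with x show "x \<in> Suc ` {x. x < m \<and> S r (Suc x) \<le> v} - {i}"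
          by (cases x) (auto simp: v_def)
      qed
      have "srank S r i \<le> card (Suc ` {x. x < m \<and> S r (Suc x) \<le> v} - {i})"
        unfolding srank_def by (intro card_mono[OF _ sub]) auto
      also have "\<dots> = cnt (S r) v - 1"
        using i' by (subst card_Diff_singleton) (auto simp: cnt_def card_image v_def)
      finally have "srank S r i \<le> cnt (S r) v - 1" .
      moreover have "real (cnt (S r) v) \<le> real (Suc v + \<beta>)"
        using bal[OF r v] by (simp add: ex_def)
      then have "cnt (S r) v \<le> Suc v + \<beta>" by (simp only: of_nat_le_iff)
      ultimately have rk: "srank S r i \<le> v + \<beta>" by simp
      \<comment> \<open>Sorting may also lower an index; \<open>max\<close> restores the premise
        \<open>v \<le> x\<close> of \<open>gap_ge\<close>.\<close>
      have "int (a (srank S r i)) \<le> int (a (max v (srank S r i)))"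
        using mono v srank_le[of i S r] i by (auto simp: mono_on_def)
      also have "\<dots> \<le> int (a v) + gap a m \<beta>"
        using rk v \<beta> srank_le[of i S r] i by (intro gap_ge) auto
      finally show ?thesis using a0_le[of v] v by (simp add: v_def)
    qed
    have "int (score a \<sigma> k (srank S) i) = int (\<sigma> i) + (\<Sum>r<k. int (a (srank S r i)))"
      by (simp add: score_def)
    also have "\<dots> \<le> int (\<sigma> i) + (\<Sum>r<k. int (a 0 + (a (S r i) - a 0)) + gap a m \<beta>)"
      using each by (intro add_left_mono sum_mono) auto
    also have "\<dots> = int (\<sigma> i) + int (k * a 0) + int (\<Sum>r<k. a (S r i) - a 0) + int k * gap a m \<beta>"
      by (simp add: sum.distrib)
    also have "\<dots> \<le> int (sm + k * a 0 + \<tau>) + int k * gap a m \<beta>"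
    proof -
      have "(\<Sum>r<k. a (S r i) - a 0) \<le> \<tau> + sm - \<sigma> i" using f by (simp add: feas_def cap_def i')
      then show ?thesis using sigma_le[OF i] by linarith
    qed
    finally show ?thesis .
  qed
  moreover have "max_score a m \<sigma> k (srank S) \<in> score a \<sigma> k (srank S) ` {1..m}"
    unfolding max_score_def using m_pos by (intro Max_in) auto
  ultimately show ?thesis by auto
qed

text \<open>The right guesses are the optimum minus \<open>sm + k * a 0\<close> for
  \<open>\<tau>\<close>, under which a normalized optimal strategy is feasible, and the
  \<open>q\<close> of \<open>choose_base\<close>. The step \<open>t\<close> is left open, since the
  program evaluates every matrix from which it moves.\<close>

lemma trajectory_approx:
  assumes k: "k \<ge> 1" and \<beta>: "beta 447 m \<le> m"
  shows "\<exists>q. 1 \<le> q \<and> q \<le> m \<and> (\<exists>\<tau>\<le>K. \<forall>Y. trajectory \<tau> q R Y \<longrightarrow>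
    (\<exists>t<R. int (max_score a m \<sigma> k (srank (Y t))) \<le>
      int (opt_score a m \<sigma> k) + int k * gap a m (beta 447 m)))"
proof -
  define T where "T = opt_score a m \<sigma> k"
  define \<tau> where "\<tau> = T - sm - k * a 0"
  obtain G where G: "\<And>i. i < m \<Longrightarrow> feas \<tau> i (\<lambda>r. G r (Suc i))"
    "\<And>r j. r < k \<Longrightarrow> j < m \<Longrightarrow> ex (G r) j = 0"
    using normalized_optimum unfolding \<tau>_def T_def by blast
  have T: "sm + k * a 0 \<le> T" "T \<le> sm + K"
    using opt_strategy max_score_ge_sm max_score_le unfolding T_def by metis+
  have approx: "int (max_score a m \<sigma> k (srank (Y t))) \<le> int T + int k * gap a m (beta 447 m)"
    if Y: "trajectory \<tau> q R Y" "t < R" and b: "\<And>r j. r < k \<Longrightarrow> j < m \<Longrightarrow> ex (Y t r) j \<le> real (beta 447 m)"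
    for q t Y
  proof -
    have "int (max_score a m \<sigma> k (srank (Y t))) \<le> int (sm + k * a 0 + \<tau>) + int k * gap a m (beta 447 m)"
      using trajectory_inv[OF Y(1), of t] Y(2) b \<beta> by (intro balanced_max_score) auto
    then show ?thesis using T by (simp add: \<tau>_def)
  qed
  have "\<exists>q\<ge>1. q \<le> m \<and> (\<forall>Y. trajectory \<tau> q R Y \<longrightarrow>
      (\<exists>t<R. \<forall>r<k. \<forall>j<m. ex (Y t r) j \<le> real (beta 447 m)))"
  proof (cases "m \<ge> 2")
    case True
    then obtain q where q: "1 \<le> q" "q ^ 2 \<le> m"
      "\<And>x. wgt q x \<le> 20 * real m ^ 2 * exp (27 * real m / real q ^ 2) \<Longrightarrow> x \<le> real (beta 447 m)"
      using choose_base by blast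
    have "q \<le> q ^ 2" using q(1) by (simp add: power2_eq_square)
    then have "q \<le> m" using q(2) by linarith
    moreover have "\<exists>t<R. \<forall>r<k. \<forall>j<m. ex (Y t r) j \<le> real (beta 447 m)" if "trajectory \<tau> q R Y" for Y
      using trajectory_balanced[OF q(1,2) k that G] q(3) by blast
    ultimately show ?thesis using q(1) by blast
  next
    case False
    \<comment> \<open>For \<open>m = 1\<close> the logarithm vanishes, but
      \<open>cnt \<le> 1\<close> leaves no positive imbalance.\<close>
    then have m1: "m = 1" using m_pos by simp
    have "ex f 0 \<le> real (beta 447 m)" for f
      unfolding ex_def using cnt_le[of f 0] m1 by linarith
    moreover have "0 < R" using k m_pos by (simp add: R_def)
    ultimately show ?thesis using m1 by (intro exI[of _ 1]) auto
  qed
  then obtain q where q: "1 \<le> q" "q \<le> m"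
    "\<And>Y. trajectory \<tau> q R Y \<Longrightarrow> \<exists>t<R. \<forall>r<k. \<forall>j<m. ex (Y t r) j \<le> real (beta 447 m)"
    by blast
  have "\<exists>t<R. int (max_score a m \<sigma> k (srank (Y t))) \<le> int T + int k * gap a m (beta 447 m)"
    if Y: "trajectory \<tau> q R Y" for Y
    using q(3)[OF Y] approx[OF Y] by blast
  moreover have "\<tau> \<le> K" using T by (simp add: \<tau>_def)
  ultimately show ?thesis using q(1,2) unfolding T_def by blast
qed

end

section \<open>Correctness of the program\<close>

definition "search = FOR vt 4 (evaluate ;; improve)"
definition "run_q = (pow_table ;; init_S ;; search)"
text \<open>\<open>vq\<close> runs over \<open>0..m - 1\<close> and stands for
  \<open>q - 1\<close>.\<close>

definition "run_tau = FOR vq 0 run_q"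
definition "main = FOR vtau 3 run_tau"

definition "mul_param p e = (SET acc (Const 0) ;; FOR vx p (ADD acc e))"
definition "row_table A p = (SET acc (Const 0) ;; FOR vx 6 (ASSIGN A (X vx) (X acc) ;; ADD acc (param p)))"
definition "sigma_max = (SET smax (Const 0) ;;
  FOR vi 0 (IF (BLess (X smax) (Load (Input 2) (Plus (X vi) (Const 1))))
    (SET smax (Load (Input 2) (Plus (X vi) (Const 1)))) NOP))"

text \<open>Every write to \<open>par\<close> stands outside the loops, between pieces of code whose
  bounds are already set; this lets \<open>timed_wf\<close> handle each piece.\<close>

definition "setup1 = (ASSIGN par (Const 0) (Load (Input 0) (Const 0)) ;;
  ASSIGN par (Const 2) (Load (Input 0) (Const 1)) ;;
  ASSIGN par (Const 1) (Plus (param 0) (Const 1)) ;;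
  ASSIGN par (Const 5) (Plus (param 0) (param 0)) ;;
  ASSIGN par (Const 6) (Plus (param 2) (Const 1)))"
definition "setup2 = mul_param 2 (Load (Input 1) (param 0))"
definition "setup3 = (mul_param 2 (Plus (param 0) (Plus (param 0) (param 0))) ;; SET wt (X acc) ;; mul_param 0 (X wt))"
definition "setup4 = (row_table rowS 1 ;; row_table rowV 3 ;; sigma_max ;; SET best (Plus (X smax) (param 3)))"
definition "program = (setup1 ;; setup2 ;; ASSIGN par (Const 3) (Plus (X acc) (Const 1)) ;;
  setup3 ;; ASSIGN par (Const 4) (X acc) ;; setup4 ;; main)"

lemma writes_search [simp]: "writes search = insert vt (writes evaluate \<union> writes improve)" and wf_search [simp]: "wf_loops search"
  by (auto simp: search_def)
lemma writes_run_q [simp]: "writes run_q = writes pow_table \<union> writes init_S \<union> writes search" and wf_run_q [simp]: "wf_loops run_q"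
  by (auto simp: run_q_def)
lemma writes_run_tau [simp]: "writes run_tau = insert vq (writes run_q)" and wf_run_tau [simp]: "wf_loops run_tau"
  by (auto simp: run_tau_def)
lemma writes_main [simp]: "writes main = insert vtau (writes run_tau)" and wf_main [simp]: "wf_loops main"
  by (auto simp: main_def)
lemma writes_mul_param [simp]: "writes (mul_param p e) = {acc, vx}" and wf_mul_param [simp]: "wf_loops (mul_param p e)"
  by (auto simp: mul_param_def)
lemma writes_row_table [simp]: "writes (row_table A p) = {acc, vx, A}"
  and wf_row_table [simp]: "A \<noteq> vx \<Longrightarrow> A \<noteq> par \<Longrightarrow> wf_loops (row_table A p)"
  by (auto simp: row_table_def)
lemma writes_sigma_max [simp]: "writes sigma_max = {smax, vi}" and wf_sigma_max [simp]: "wf_loops sigma_max"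
  by (auto simp: sigma_max_def)
lemma writes_setup2 [simp]: "writes setup2 = {acc, vx}" and wf_setup2 [simp]: "wf_loops setup2"
  by (auto simp: setup2_def)
lemma writes_setup3 [simp]: "writes setup3 = {acc, vx, wt}" and wf_setup3 [simp]: "wf_loops setup3"
  by (auto simp: setup3_def)
lemma writes_setup4 [simp]: "writes setup4 = {acc, vx, rowS, rowV, smax, vi, best}" and wf_setup4 [simp]: "wf_loops setup4"
  by (auto simp: setup4_def)

lemma mul_param:
  assumes "\<And>s'. (\<And>b. b \<notin> {acc, vx} \<Longrightarrow> s' b = s b) \<Longrightarrow> aval e s' = c"
  shows "eval (mul_param p e) s acc 0 = s par p * c"
  unfolding mul_param_def eval.simps(3)
proof (rule FOR_rule[where I = "\<lambda>n s'. s' acc 0 = n * c"], goal_cases)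
  case (7 i s')
  have "aval e s' = c" using 7(4) by (intro assms) auto
  then show ?case using 7(2) by simp
qed auto

lemma row_table:
  assumes "A \<notin> {vx, par, acc}" "s par 6 = Suc n" "r \<le> n"
  shows "eval (row_table A p) s A r = r * s par p"
proof -
  have "eval (row_table A p) s acc 0 = Suc n * s par p \<and> (\<forall>r<Suc n. eval (row_table A p) s A r = r * s par p)"
    unfolding row_table_def eval.simps(3)
  proof (rule FOR_rule[where I = "\<lambda>n s'. s' acc 0 = n * s par p \<and> (\<forall>r<n. s' A r = r * s par p)"], goal_cases)
    case (7 i s')
    have "s' par = s par" using 7(4)[of par] assms by auto
    then show ?case using 7(2,3) assms by (auto simp: less_Suc_eq)
  qed (use assms in auto)
  then show ?thesis using assms(3) by auto
qed

context ucm begin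

abbreviation "ms T \<equiv> max_score a m \<sigma> k T"

text \<open>The value \<open>sm + K + 1\<close> exceeds the score of every strategy and marks that
  none has been stored yet.\<close>

definition "inv_out s \<longleftrightarrow> s best 0 = sm + Suc K \<or>
  tbl (s Output) \<in> strategies m k \<and> ms (tbl (s Output)) = s best 0"

lemma near_strategies:
  assumes "near T T'" "T' \<in> strategies m k"
  shows "T \<in> strategies m k"
proof -
  have "bij_betw (T r) {0..m} {0..m}" if "r < k" for r
    using bij_betw_cong[of "{0..m}" "T r" "T' r" "{0..m}"] assms that
    by (simp add: near_def strategies_def)
  then show ?thesis by (simp add: strategies_def)
qed

lemma near_ms: "near T T' \<Longrightarrow> ms T = ms T'"
  unfolding max_score_def score_def near_def
  by (intro arg_cong[where f = Max] image_cong refl arg_cong2[where f = "(+)"] sum.cong) auto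

lemma evaluate:
  assumes "env s" "inv_out s"
  defines "s' \<equiv> eval evaluate s"
  shows "inv_out s' \<and> s' best 0 \<le> s best 0 \<and> s' best 0 \<le> ms (srank (tbl (s arrS)))"
proof -
  let ?S = "srank (tbl (s arrS))"
  define s1 where "s1 = eval rank_all s"
  define s2 where "s2 = eval score_max s1"
  have e: "env s1" "env s2" using assms(1) by (simp_all add: s1_def s2_def env_arrs_def)
  have rk: "near (tbl (s1 arrRank)) ?S"
    using rank_all[OF assms(1)] by (simp add: near_def s1_def)
  have "tbl (s1 arrRank) r i \<le> m" if "r < k" "i \<le> m" for r i
    using rk that srank_le by (simp add: near_def)
  then have mx: "s2 mx 0 = ms ?S"
    using score_max[OF e(1)] near_ms[OF rk] by (simp add: s2_def)
  have fr: "s2 best = s best" "s2 Output = s Output" "s2 arrRank = s1 arrRank"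
    by (simp_all add: s1_def s2_def eval_frame)
  have s': "s' = (if ms ?S < s best 0 then eval copy_all (upd s2 best 0 (ms ?S)) else s2)"
    using mx fr by (simp add: s'_def evaluate_def s1_def s2_def)
  show ?thesis
  proof (cases "ms ?S < s best 0")
    case False
    then show ?thesis using assms(2) by (simp add: s' fr inv_out_def)
  next
    case True
    let ?s = "upd s2 best 0 (ms ?S)"
    have "env ?s" using e by (simp add: env_arrs_def)
    then have "near (tbl (eval copy_all ?s Output)) (tbl (s1 arrRank))"
      using copy_all by (simp add: near_def fr)
    with rk have "near (tbl (s' Output)) ?S" using True by (simp add: s' near_def)
    then have "tbl (s' Output) \<in> strategies m k" "ms (tbl (s' Output)) = ms ?S"
      using near_strategies srank_strategies near_ms by blast+
    moreover have "s' best 0 = ms ?S" using True by (simp add: s' eval_frame)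
    ultimately show ?thesis using True by (simp add: inv_out_def)
  qed
qed

text \<open>What a finished search leaves behind: \<open>b\<close> is no worse than any matrix that
  it evaluated. This survives later decreases of \<open>best\<close>, so the outer loops can collect
  it for all guesses.\<close>

definition "covered b \<tau> q \<longleftrightarrow> (\<exists>Y. trajectory \<tau> q R Y \<and> (\<forall>t<R. b \<le> ms (srank (Y t))))"

lemma covered_mono: "covered b \<tau> q \<Longrightarrow> b' \<le> b \<Longrightarrow> covered b' \<tau> q"
  unfolding covered_def by (meson order.trans)

text \<open>Each pass evaluates before it improves, so the matrices judged are \<open>Y 0\<close> to
  \<open>Y (R - 1)\<close>, matching the bound \<open>t < R\<close> in
  \<open>trajectory_balanced\<close>.\<close>

lemma search:
  assumes "env s" "inv_out s" "\<forall>x<2*m. s arrF x = weight q x" "near (tbl (s arrS)) start"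
  defines "s' \<equiv> eval search s"
  shows "inv_out s' \<and> s' best 0 \<le> s best 0 \<and> covered (s' best 0) (s vtau 0) q"
proof -
  let ?I = "\<lambda>n s'. inv_out s' \<and> s' best 0 \<le> s best 0 \<and>
    (\<exists>Y. trajectory (s vtau 0) q n Y \<and> Y n = tbl (s' arrS) \<and> (\<forall>t<n. s' best 0 \<le> ms (srank (Y t))))"
  have "?I R s'"
    unfolding s'_def search_def
  proof (rule FOR_rule[where I = ?I], goal_cases)
    case 5
    then show ?case using assms by (auto simp: trajectory_def intro!: exI[of _ "\<lambda>_. tbl (s arrS)"])
  next
    case (6 i s' x)
    then show ?case by (simp add: inv_out_def)
  next
    case (7 n s1)
    from 7(2) obtain Y where Y: "trajectory (s vtau 0) q n Y" "Y n = tbl (s1 arrS)"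
      "\<forall>t<n. s1 best 0 \<le> ms (srank (Y t))" by auto
    have fr: "s1 b = s b" if "b \<notin> insert vt (writes evaluate \<union> writes improve)" for b
      using 7(4)[of b] that by auto
    have e: "env s1" using assms(1) by (subst env_cong[of s1 s]) (auto simp: env_arrs_def fr)
    define s2 where "s2 = eval evaluate s1"
    define s3 where "s3 = eval improve s2"
    have ev: "inv_out s2" "s2 best 0 \<le> s1 best 0" "s2 best 0 \<le> ms (srank (Y n))"
      using evaluate[OF e] 7(2) Y(2) by (auto simp: s2_def)
    have e2: "env s2" using e by (simp add: s2_def env_arrs_def)
    have "\<forall>x<2*m. s2 arrF x = weight q x" using assms(3) by (simp add: s2_def eval_frame fr)
    from improve[OF e2 this] obtain i vs where
      imp: "best_step (s vtau 0) q (Y n) i vs m" "near (tbl (s3 arrS)) (setcol (Y n) i vs)"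
      by (auto simp: s3_def near_def s2_def eval_frame fr Y(2))
    have fr3: "s3 best = s2 best" "s3 Output = s2 Output" by (simp_all add: s3_def eval_frame)
    \<comment> \<open>The trajectory is extended by the matrix actually stored, which agrees with
      the best step up to \<open>near\<close>.\<close>
    define Z where "Z = Y(Suc n := tbl (s3 arrS))"
    have "trajectory (s vtau 0) q (Suc n) Z"
      using Y(1) imp unfolding trajectory_def Z_def by (auto simp: less_Suc_eq)
    moreover have "\<forall>t<Suc n. s3 best 0 \<le> ms (srank (Z t))"
      using Y(3) ev by (auto simp: Z_def fr3 less_Suc_eq intro: order.trans)
    moreover have "inv_out s3" using ev(1) by (simp add: inv_out_def fr3)
    moreover have "s3 best 0 \<le> s best 0" using ev(2) 7(2) by (simp add: fr3)
    ultimately have "?I (Suc n) s3" by (auto simp: Z_def)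
    then show ?case by (simp add: s3_def s2_def)
  qed (use assms in auto)
  then show ?thesis unfolding covered_def by blast
qed

lemma run_q:
  assumes "env s" "inv_out s" "s vq 0 < m"
  defines "s' \<equiv> eval run_q s"
  shows "inv_out s' \<and> s' best 0 \<le> s best 0 \<and> covered (s' best 0) (s vtau 0) (Suc (s vq 0))"
proof -
  define s1 where "s1 = eval pow_table s"
  define s2 where "s2 = eval init_S s1"
  have e: "env s1" "env s2" using assms(1) by (simp_all add: s1_def s2_def env_arrs_def)
  have "inv_out s2" using assms(2) by (simp add: s1_def s2_def inv_out_def eval_frame)
  moreover have "\<forall>x<2*m. s2 arrF x = weight (Suc (s vq 0)) x"
    using pow_table[OF assms(1,3)] by (simp add: s2_def s1_def eval_frame weight_def)
  moreover have "near (tbl (s2 arrS)) start" using init_S[OF e(1)] by (simp add: near_def s2_def)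
  ultimately have "inv_out s' \<and> s' best 0 \<le> s2 best 0 \<and> covered (s' best 0) (s2 vtau 0) (Suc (s vq 0))"
    using search[OF e(2), of "Suc (s vq 0)"] by (simp add: s'_def run_q_def s1_def s2_def)
  then show ?thesis by (simp add: s1_def s2_def eval_frame)
qed

lemma run_tau:
  assumes "env s" "inv_out s"
  defines "s' \<equiv> eval run_tau s"
  shows "inv_out s' \<and> s' best 0 \<le> s best 0 \<and> (\<forall>q<m. covered (s' best 0) (s vtau 0) (Suc q))"
  unfolding s'_def run_tau_def
proof (rule FOR_rule[where I = "\<lambda>n s'. inv_out s' \<and> s' best 0 \<le> s best 0 \<and>
    (\<forall>q<n. covered (s' best 0) (s vtau 0) (Suc q))"], goal_cases)
  case (6 i s' x)
  then show ?case by (simp add: inv_out_def)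
next
  case (7 q s1)
  have fr: "s1 b = s b" if "b \<notin> insert vq (writes run_q)" for b
    using 7(4)[of b] that by auto
  have e: "env s1" using assms(1) by (subst env_cong[of s1 s]) (auto simp: env_arrs_def fr)
  have "s1 vtau = s vtau" by (simp add: fr)
  then have "inv_out (eval run_q s1) \<and> eval run_q s1 best 0 \<le> s1 best 0 \<and>
      covered (eval run_q s1 best 0) (s vtau 0) (Suc q)"
    using run_q[OF e] 7 by simp
  then show ?case using 7(2) by (auto simp: less_Suc_eq intro: covered_mono)
qed (use assms in auto)

lemma main:
  assumes "env s" "inv_out s"
  defines "s' \<equiv> eval main s"
  shows "inv_out s' \<and> s' best 0 \<le> s best 0 \<and> (\<forall>\<tau><Suc K. \<forall>q<m. covered (s' best 0) \<tau> (Suc q))"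
  unfolding s'_def main_def
proof (rule FOR_rule[where I = "\<lambda>n s'. inv_out s' \<and> s' best 0 \<le> s best 0 \<and>
    (\<forall>\<tau><n. \<forall>q<m. covered (s' best 0) \<tau> (Suc q))"], goal_cases)
  case (6 i s' x)
  then show ?case by (simp add: inv_out_def)
next
  case (7 \<tau> s1)
  have fr: "s1 b = s b" if "b \<notin> insert vtau (writes run_tau)" for b
    using 7(4)[of b] that by auto
  have e: "env s1" using assms(1) by (subst env_cong[of s1 s]) (auto simp: env_arrs_def fr)
  then have "inv_out (eval run_tau s1) \<and> eval run_tau s1 best 0 \<le> s1 best 0 \<and>
      (\<forall>q<m. covered (eval run_tau s1 best 0) \<tau> (Suc q))"
    using run_tau[OF e] 7 by simp
  then show ?case using 7(2) by (auto simp: less_Suc_eq intro: covered_mono)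
qed (use assms in auto)

lemma sigma_max:
  assumes "s par 0 = m" "\<forall>i\<le>m. s (Input 2) i = \<sigma> i"
  shows "eval sigma_max s smax 0 = sm"
proof -
  let ?I = "\<lambda>n s'. s' smax 0 = Max (insert 0 ((\<lambda>i. \<sigma> (Suc i)) ` {..<n}))"
  have "?I m (eval sigma_max s)"
    unfolding sigma_max_def eval.simps(3)
  proof (rule FOR_rule[where I = ?I], goal_cases)
    case (7 i s')
    have "s' (Input 2) (Suc i) = \<sigma> (Suc i)" using 7(4)[of "Input 2"] 7(1) assms by simp
    then show ?case
      unfolding Max_insert_0_lessThan_Suc 7(2)[symmetric] by (simp add: max_def 7(3))
  qed (use assms in auto)
  then show ?thesis by (simp only: Max_insert_0_Suc sm_def)
qed

definition par_final :: "nat \<Rightarrow> nat" where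
  "par_final = (\<lambda>_. 0)(0 := m, 1 := Suc m, 2 := k, 3 := Suc K, 4 := R, 5 := 2 * m, 6 := Suc k)"

lemma program:
  assumes B: "\<And>p. par_final p \<le> B"
  defines "I \<equiv> ucm_input a m \<sigma> k"
  shows "timed B program I" "\<exists>s. eval program I = eval main s \<and> env s \<and> s best 0 = sm + Suc K"
proof -
  define s1 where "s1 = eval setup1 I"
  define s2 where "s2 = eval setup2 s1"
  define s3 where "s3 = eval (ASSIGN par (Const 3) (Plus (X acc) (Const 1))) s2"
  define s4 where "s4 = eval setup3 s3"
  define s5 where "s5 = eval (ASSIGN par (Const 4) (X acc)) s4"
  define s6 where "s6 = eval setup4 s5"
  have p1: "s1 par = (\<lambda>_. 0)(0 := m, 1 := Suc m, 2 := k, 5 := 2 * m, 6 := Suc k)"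
    by (auto simp: s1_def setup1_def I_def ucm_input_def fun_eq_iff)
  have i1: "s1 (Input 1) = (\<lambda>i. if i \<le> m then a i else 0)" "s1 (Input 2) = (\<lambda>i. if i \<le> m then \<sigma> i else 0)"
    by (auto simp: s1_def setup1_def I_def ucm_input_def)
  have "s2 acc 0 = s1 par 2 * a m"
    unfolding s2_def setup2_def by (rule mul_param) (simp add: p1 i1[simplified])
  then have p3: "s3 par = (\<lambda>_. 0)(0 := m, 1 := Suc m, 2 := k, 3 := Suc K, 5 := 2 * m, 6 := Suc k)"
    by (auto simp: s3_def s2_def eval_frame p1 K_def fun_eq_iff)
  have "eval (mul_param 2 (Plus (param 0) (Plus (param 0) (param 0)))) s3 acc 0 = s3 par 2 * (m + (m + m))"
    by (rule mul_param) (simp add: p3)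
  then have wt: "eval (mul_param 2 (Plus (param 0) (Plus (param 0) (param 0))) ;; SET wt (X acc)) s3 wt 0 = k * (m + (m + m))"
    by (simp add: p3)
  have "s4 acc 0 = s3 par 0 * (k * (m + (m + m)))"
    unfolding s4_def setup3_def eval.simps(3)
    using mul_param[of "eval (mul_param 2 (Plus (param 0) (Plus (param 0) (param 0))) ;; SET wt (X acc)) s3" "X wt" _ 0] wt
    by (simp add: eval_frame)
  then have p5: "s5 par = par_final"
    by (auto simp: s5_def s4_def eval_frame p3 R_def par_final_def fun_eq_iff)
  have pf: "par_final 0 = m" "par_final 1 = Suc m" "par_final 2 = k" "par_final 3 = Suc K" "par_final 4 = R"
    "par_final 5 = 2 * m" "par_final 6 = Suc k"
    by (simp_all add: par_final_def)
  have fr6: "s6 b = s1 b" if "b \<notin> writes setup4 \<union> writes setup3 \<union> writes setup2 \<union> {par}" for b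
    using that by (simp add: s6_def s5_def s4_def s3_def s2_def eval_frame)
  have p6: "s6 par = par_final" by (simp add: s6_def eval_frame p5)
  have r6: "s6 rowS r = r * Suc m" "s6 rowV r = r * Suc K" if "r \<le> k" for r
  proof -
    have "eval (row_table rowS 1) s5 rowS r = r * s5 par 1"
      using that by (intro row_table) (auto simp: p5 pf)
    then show "s6 rowS r = r * Suc m"
      by (simp add: s6_def setup4_def eval_frame p5 pf del: mult_Suc_right One_nat_def)
    have "eval (row_table rowV 3) (eval (row_table rowS 1) s5) rowV r = r * s5 par 3"
      using that by (subst row_table) (auto simp: p5 pf eval_frame)
    then show "s6 rowV r = r * Suc K"
      by (simp add: s6_def setup4_def eval_frame p5 pf del: mult_Suc_right One_nat_def)
  qed
  define s5' where "s5' = eval (row_table rowV 3) (eval (row_table rowS 1) s5)"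
  have "eval sigma_max s5' smax 0 = sm"
  proof (rule sigma_max)
    show "s5' par 0 = m" by (simp add: s5'_def eval_frame p5 pf)
    show "\<forall>i\<le>m. s5' (Input 2) i = \<sigma> i"
      by (simp add: s5'_def eval_frame s5_def s4_def s3_def s2_def i1)
  qed
  moreover have "s6 = upd (eval sigma_max s5') best 0 (eval sigma_max s5' smax 0 + eval sigma_max s5' par 3)"
    by (simp add: s6_def setup4_def s5'_def)
  moreover have "eval sigma_max s5' par 3 = Suc K" by (simp add: s5'_def eval_frame p5 pf)
  ultimately have b6: "s6 best 0 = sm + Suc K" "s6 smax 0 = sm" by simp_all
  have e6: "env s6"
    unfolding env_def using r6 b6 i1 by (simp add: p6 pf fr6 pf(2)[simplified])
  have ev: "eval program I = eval main s6"
    by (simp add: program_def s6_def s5_def s4_def s3_def s2_def s1_def)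
  show "\<exists>s. eval program I = eval main s \<and> env s \<and> s best 0 = sm + Suc K"
    using ev e6 b6 by blast
  \<comment> \<open>Cells of \<open>par\<close> not yet set are 0, so the final bound
    \<open>B\<close> serves every stage.\<close>
  have le: "s1 par p \<le> B" "s3 par p \<le> B" "s5 par p \<le> B" for p
    using B[of p] by (auto simp: p1 p3 p5 par_final_def split: if_splits)
  have "timed B setup1 I" unfolding setup1_def by (intro timed_Seq timed_ASSIGN)
  moreover have "timed B setup2 s1" by (rule timed_wf) (auto simp: le)
  moreover have "timed B setup3 s3" by (rule timed_wf) (auto simp: le)
  moreover have "timed B setup4 s5" by (rule timed_wf) (auto simp: le)
  moreover have "timed B main s6" using B by (intro timed_wf) (auto simp: p6)
  ultimately show "timed B program I"
    unfolding program_def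
    by (intro timed_Seq timed_ASSIGN) (simp_all only: s1_def s2_def s3_def s4_def s5_def s6_def)
qed

lemma program_correct:
  defines "s \<equiv> eval program (ucm_input a m \<sigma> k)"
  assumes \<beta>: "beta 447 m \<le> m"
  shows "ucm_output m s \<in> strategies m k \<and>
    int (ms (ucm_output m s)) \<le> int (opt_score a m \<sigma> k) + int k * gap a m (beta 447 m)"
proof (cases "k = 0")
  \<comment> \<open>Without manipulators \<open>R = 0\<close> and nothing is evaluated, but every
    output is a strategy and all have the same scores.\<close>
  case True
  have all: "T \<in> strategies m k" for T using True by (simp add: strategies_def)
  have eq: "ms T = ms T'" for T T' using True by (simp add: max_score_def score_def)
  obtain S where "ms S = opt_score a m \<sigma> k" using opt_strategy by blast
  then show ?thesis using all eq[of "ucm_output m s" S] True by simp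
next
  case False
  have out: "ucm_output m s = tbl (s Output)" by (simp add: ucm_output_def tbl_def fun_eq_iff)
  have "par_final p \<le> Max (range par_final)" for p
  proof (rule Max_ge)
    have "range par_final \<subseteq> {0, m, Suc m, k, Suc K, R, 2 * m, Suc k}" by (auto simp: par_final_def)
    then show "finite (range par_final)" by (rule finite_subset) simp
  qed simp
  from program(2)[OF this] obtain s0 where s0: "s = eval main s0" "env s0" "s0 best 0 = sm + Suc K"
    by (auto simp: s_def)
  have "inv_out s0" using s0(3) by (simp add: inv_out_def)
  from main[OF s0(2) this] have M: "inv_out s" "\<forall>\<tau><Suc K. \<forall>q<m. covered (s best 0) \<tau> (Suc q)"
    by (auto simp: s0(1))
  obtain q \<tau> where q: "1 \<le> q" "q \<le> m" "\<tau> \<le> K" and tr: "\<And>Y. trajectory \<tau> q R Y \<Longrightarrow>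
    \<exists>t<R. int (ms (srank (Y t))) \<le> int (opt_score a m \<sigma> k) + int k * gap a m (beta 447 m)"
    using trajectory_approx[OF _ \<beta>] False by auto
  have "covered (s best 0) \<tau> q" using M(2) q by (cases q) auto
  then obtain Y t where Y: "s best 0 \<le> ms (srank (Y t))"
    "int (ms (srank (Y t))) \<le> int (opt_score a m \<sigma> k) + int k * gap a m (beta 447 m)"
    using tr unfolding covered_def by blast
  \<comment> \<open>This rules out the marker value \<open>sm + K + 1\<close>, so a strategy has
    been stored.\<close>
  have "s best 0 \<le> sm + K" using Y(1) max_score_le[OF srank_strategies] by (meson order.trans)
  then show ?thesis using M(1) Y by (auto simp: inv_out_def out)
qed

end

section \<open>Polynomial running time and the theorem\<close>

lemma poly_mono_nat: "x \<le> y \<Longrightarrow> poly p x \<le> poly p (y :: nat)"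
  by (induction p) (auto intro!: add_mono mult_mono)

theorem theorem1:
  fixes \<alpha> :: "nat \<Rightarrow> nat \<Rightarrow> nat"
  assumes "positional_scoring_rule \<alpha>"
  shows "\<exists>d::real. d > 0 \<and>
    (\<exists>(prog :: com) (time :: nat poly) (c :: real). c > 0 \<and>
      (\<forall>m k :: nat. \<forall>\<sigma> :: nat \<Rightarrow> nat. m \<ge> 1 \<longrightarrow>
        (let t = poly time (ucm_size m \<sigma> k);
             I = ucm_input (\<alpha> m) m \<sigma> k;
             \<beta> = beta d m
         in halts_within t prog I \<and>
            (\<beta> \<le> m \<longrightarrow>
              measure_pmf.prob (final_store t prog I)
                {s. \<not> (ucm_output m s \<in> strategies m k \<and>
                       int (max_score (\<alpha> m) m \<sigma> k (ucm_output m s))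
                         \<le> int (opt_score (\<alpha> m) m \<sigma> k) + int k * gap (\<alpha> m) m \<beta>)}
              \<le> exp (- c * real m)))))"
proof -
  obtain P :: "nat poly" where P: "\<And>m. \<alpha> m m \<le> poly P m" and mono: "\<And>m. mono_on {0..m} (\<alpha> m)"
    using assms by (auto simp: positional_scoring_rule_def)
  \<comment> \<open>At the input size \<open>n\<close>, \<open>n * P n\<close> bounds
    \<open>K\<close>, \<open>3 * n^3\<close> bounds \<open>R\<close>, and \<open>2 + 2 * n\<close>
    covers the remaining parameters and successors.\<close>
  define B where "B = [:0, 1:] * P + [:2, 2, 0, 3:]"
  define time where "time = pcompose (time_poly program) B"
  have run: "run (poly time (ucm_size m \<sigma> k)) (compile program) (ucm_input (\<alpha> m) m \<sigma> k) =
      return_pmf (Skip, eval program (ucm_input (\<alpha> m) m \<sigma> k))" if "m \<ge> 1" for m k \<sigma>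
  proof -
    interpret ucm m k "\<alpha> m" \<sigma> using that mono by unfold_locales
    define n where "n = ucm_size m \<sigma> k"
    have n: "m \<le> n" "k \<le> n" by (simp_all add: n_def ucm_size_def)
    have "K \<le> n * poly P n"
      unfolding K_def using n P[of m] poly_mono_nat[OF n(1), of P] by (intro mult_mono) auto
    moreover have "R \<le> 3 * n * n * n" unfolding R_def using n by (intro mult_mono) auto
    moreover have "poly B n = n * poly P n + (2 + 2 * n + 3 * n * n * n)"
      by (simp add: B_def algebra_simps)
    ultimately have "par_final p \<le> poly B n" for p
      using n unfolding par_final_def by auto
    from program(1)[OF this] obtain j where "j \<le> poly time n"
      "steps j (compile program) (ucm_input (\<alpha> m) m \<sigma> k) Skip (eval program (ucm_input (\<alpha> m) m \<sigma> k))"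
      by (auto simp: timed_def time_def poly_pcompose)
    then show ?thesis unfolding n_def by (intro run_steps)
  qed
  have "let t = poly time (ucm_size m \<sigma> k);
             I = ucm_input (\<alpha> m) m \<sigma> k;
             \<beta> = beta 447 m
         in halts_within t (compile program) I \<and>
            (\<beta> \<le> m \<longrightarrow>
              measure_pmf.prob (final_store t (compile program) I)
                {s. \<not> (ucm_output m s \<in> strategies m k \<and>
                       int (max_score (\<alpha> m) m \<sigma> k (ucm_output m s))
                         \<le> int (opt_score (\<alpha> m) m \<sigma> k) + int k * gap (\<alpha> m) m \<beta>)}
              \<le> exp (- 1 * real m))" if "m \<ge> 1" for m k \<sigma>
  proof -
    interpret ucm m k "\<alpha> m" \<sigma> using that mono by unfold_locales
    \<comment> \<open>The run is deterministic: the final store is a point mass on a correct output,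
      so the failure probability is 0.\<close>
    show ?thesis
      using program_correct
      by (simp add: Let_def halts_within_def final_store_def run[OF that] measure_return_pmf indicator_def)
  qed
  then show ?thesis
    by (intro exI[of _ "447::real"] exI[of _ "compile program"] exI[of _ time] exI[of _ "1::real"] conjI) auto
qed

end
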